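(* Given an odometer system $(X,H_X)$, there exists a minimal homeomorphism of the Fraïssé fence which admits $H_X$ as a factor.
   Context: An odometer: for a sequence $p=(p_i)$ of positive integers with $p_i\mid p_{i+1}$ and $p_i<p_{i+1}$, $X=\varprojlim\mathbb{Z}/p_i\mathbb{Z}$ (bonding maps reduction mod $p_i$) and $H_X$ is addition of $1$ in every coordinate. Fences: for $\Phi=(\varphi^L,\varphi^U)$ with $\varphi^L,\varphi^U$ from a Cantor space $Y$ to $[0,1]$, $\varphi^L$ lower semicontinuous, $\varphi^U$ upper semicontinuous, $\varphi^L\le\varphi^U$, $\mathbf{F}_\Phi=\{(y,t):\varphi^L(y)\le t\le\varphi^U(y)\}$ and $\mathbf{F}_\Phi(y)=\{t:(y,t)\in\mathbf{F}_\Phi\}$. $\mathbf{F}_\Phi$ is a Fraïssé fence if for every $y$ and every continuum $I\subseteq\mathbf{F}_\Phi(y)$ there is a sequence $y_k\ne y$, $y_k\to y$, with each $\mathbf{F}_\Phi(y_k)$ a nondegenerate arc and $\mathbf{F}_\Phi(y_k)\to I$ in the Hausdorff metric; all Fraïssé fences are homeomorphic, and "the Fraïssé fence" refers to this space. A homeomorphism is minimal if every orbit is dense; $H_X$ is a factor of $T$ if there is a continuous surjection $\pi$ with $\pi\circ T=H_X\circ\pi$. *)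

theory Defs
  imports "HOL-Analysis.Analysis"
begin

definition odometer_seq :: "(nat \<Rightarrow> nat) \<Rightarrow> bool" where
  "odometer_seq p \<longleftrightarrow> (\<forall>i. 0 < p i \<and> p i dvd p (Suc i) \<and> p i < p (Suc i))"

text \<open>The inverse limit of Z/p_i Z with bonding maps reduction mod p_i, realised as
  a subset of the product space nat => nat (product of discrete spaces).\<close>
definition odometer_space :: "(nat \<Rightarrow> nat) \<Rightarrow> (nat \<Rightarrow> nat) set" where
  "odometer_space p = {x. (\<forall>i. x i < p i \<and> x i = x (Suc i) mod p i)}"

definition odometer_map :: "(nat \<Rightarrow> nat) \<Rightarrow> (nat \<Rightarrow> nat) \<Rightarrow> (nat \<Rightarrow> nat)" where
  "odometer_map p x = (\<lambda>i. (x i + 1) mod p i)"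

definition cantor_space :: "'a::metric_space set \<Rightarrow> bool" where
  "cantor_space Y \<longleftrightarrow> Y \<noteq> {} \<and> compact Y \<and> (\<forall>y\<in>Y. y islimpt Y) \<and>
     (\<forall>C. C \<subseteq> Y \<and> connected C \<longrightarrow> (\<exists>a. C \<subseteq> {a}))"

definition lower_semicontinuous_on :: "'a::topological_space set \<Rightarrow> ('a \<Rightarrow> real) \<Rightarrow> bool" where
  "lower_semicontinuous_on Y f \<longleftrightarrow> (\<forall>a. openin (top_of_set Y) {y\<in>Y. a < f y})"

definition upper_semicontinuous_on :: "'a::topological_space set \<Rightarrow> ('a \<Rightarrow> real) \<Rightarrow> bool" where
  "upper_semicontinuous_on Y f \<longleftrightarrow> (\<forall>a. openin (top_of_set Y) {y\<in>Y. f y < a})"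

text \<open>Hausdorff distance (used only for nonempty compact sets of reals).\<close>
definition hausdorff_dist :: "real set \<Rightarrow> real set \<Rightarrow> real" where
  "hausdorff_dist A B = max (SUP a\<in>A. infdist a B) (SUP b\<in>B. infdist b A)"

definition fence :: "'a set \<Rightarrow> ('a \<Rightarrow> real) \<Rightarrow> ('a \<Rightarrow> real) \<Rightarrow> ('a \<times> real) set" where
  "fence Y fL fU = {(y, t). y \<in> Y \<and> fL y \<le> t \<and> t \<le> fU y}"

definition fence_fibre :: "('a \<Rightarrow> real) \<Rightarrow> ('a \<Rightarrow> real) \<Rightarrow> 'a \<Rightarrow> real set" where
  "fence_fibre fL fU y = {t. fL y \<le> t \<and> t \<le> fU y}"

definition fence_data :: "'a::metric_space set \<Rightarrow> ('a \<Rightarrow> real) \<Rightarrow> ('a \<Rightarrow> real) \<Rightarrow> bool" where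
  "fence_data Y fL fU \<longleftrightarrow> cantor_space Y \<and>
     (\<forall>y\<in>Y. 0 \<le> fL y \<and> fL y \<le> fU y \<and> fU y \<le> 1) \<and>
     lower_semicontinuous_on Y fL \<and> upper_semicontinuous_on Y fU"

definition fraisse_fence :: "'a::metric_space set \<Rightarrow> ('a \<Rightarrow> real) \<Rightarrow> ('a \<Rightarrow> real) \<Rightarrow> bool" where
  "fraisse_fence Y fL fU \<longleftrightarrow> fence_data Y fL fU \<and>
     (\<forall>y\<in>Y. \<forall>I. I \<noteq> {} \<and> compact I \<and> connected I \<and> I \<subseteq> fence_fibre fL fU y \<longrightarrow>
        (\<exists>yk :: nat \<Rightarrow> 'a. (\<forall>k. yk k \<in> Y \<and> yk k \<noteq> y \<and> fL (yk k) < fU (yk k)) \<and>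
            yk \<longlonglongrightarrow> y \<and>
            (\<lambda>k. hausdorff_dist (fence_fibre fL fU (yk k)) I) \<longlonglongrightarrow> 0))"

definition minimal_homeomorphism :: "'a::topological_space set \<Rightarrow> ('a \<Rightarrow> 'a) \<Rightarrow> bool" where
  "minimal_homeomorphism S T \<longleftrightarrow> (\<exists>T'. homeomorphism S S T T' \<and>
     (\<forall>x\<in>S. S \<subseteq> closure ({(T ^^ n) x | n. True} \<union> {(T' ^^ n) x | n. True})))"

definition is_factor :: "'a::topological_space set \<Rightarrow> ('a \<Rightarrow> 'a) \<Rightarrow>
    'b::topological_space set \<Rightarrow> ('b \<Rightarrow> 'b) \<Rightarrow> bool" where
  "is_factor S T Z H \<longleftrightarrow> (\<exists>\<pi>. continuous_on S \<pi> \<and> \<pi> ` S = Z \<and> (\<forall>z\<in>S. \<pi> (T z) = H (\<pi> z)))"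

end

theory Submission
  imports Defs
begin

text \<open>The homeomorphism is built directly on the given fence. Label the points of the base by
  coherent residues modulo \<open>P n\<close>, where \<open>P n\<close> divides some term of \<open>p\<close>, so that the cells of equal
  label shrink, and choose in every cell a point whose fibre is nondegenerate and approximates
  all fibres over the cell. Approximating subintervals of fibres by fibres, the cells of one stage
  can be subdivided so that the relative positions of the chosen fibres of the subcells are almost
  the same in every cell. Adding 1 to all labels is then a homeomorphism of the base; the affine
  maps between the chosen fibres of successive cells converge uniformly and give the lift to the
  fence, once the fibres at the two ends of each odometer cycle are made to shrink to points.
  Every orbit meets every cell, and the Fraisse property provides cells whose part of the fence is
  close to any prescribed point, so the lift is minimal; the labels give the factor map.\<close>

text \<open>The fence dictates how many subcells a cell needs, so each modulus is taken far enough
  along \<open>p\<close>; divisibility in both directions then recovers the odometer. Write a label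
  of the next stage as \<open>w + P * i\<close>, with old label \<open>w\<close> and digit
  \<open>i\<close>. Adding 1 keeps the digit unless \<open>w = P - 1\<close>. While the digit is
  kept, the uniform relative positions make the new affine map an almost exact refinement of the old
  one, with summable errors. Accuracy has to be relative to the lengths of the chosen fibres: these
  lengths have no lower bound, yet the limit must be injective on nondegenerate fibres, so ratios of
  lengths must be controlled. Semicontinuity bounds nearby fibres from outside only, which explains
  the one-sided notion \<open>near\<close>.\<close>

lemma LEAST_clopen_cover_continuous:
  fixes W :: "nat \<Rightarrow> 'a::topological_space set"
  assumes op: "\<And>k. k < N \<Longrightarrow> openin (top_of_set Y) (W k)"
    and cl: "\<And>k. k < N \<Longrightarrow> closedin (top_of_set Y) (W k)"
    and cover: "\<And>y. y \<in> Y \<Longrightarrow> \<exists>k<N. y \<in> W k"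
  shows "continuous_on Y (\<lambda>y. LEAST k. y \<in> W k)"
proof -
  have least: "(LEAST k. y \<in> W k) < N \<and> y \<in> W (LEAST k. y \<in> W k)" if "y \<in> Y" for y
    by (metis (no_types, lifting) LeastI Least_le cover le_less_trans that)
  have eq: "{y\<in>Y. (LEAST k. y \<in> W k) = m} = (if m < N then W m - (\<Union>k<m. W k) else {})" for m
  proof (cases "m < N")
    case True
    then have "W m \<subseteq> Y" using op openin_imp_subset by blast
    moreover have "(LEAST k. y \<in> W k) = m" if "y \<in> W m" "\<forall>k<m. y \<notin> W k" for y
      by (rule Least_equality) (use that not_le in auto)
    moreover have "y \<in> W m \<and> (\<forall>k<m. y \<notin> W k)" if "y \<in> Y" "(LEAST k. y \<in> W k) = m" for y
      using least[OF that(1)] not_less_Least[of _ "\<lambda>k. y \<in> W k"] unfolding that(2) by simp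
    ultimately have "{y\<in>Y. (LEAST k. y \<in> W k) = m} = W m - (\<Union>k<m. W k)" by blast
    then show ?thesis using True by simp
  qed (use least in auto)
  have "openin (top_of_set Y) {y\<in>Y. (LEAST k. y \<in> W k) = m}" for m
    unfolding eq using op cl by (auto intro!: openin_diff closedin_Union)
  then have "openin (top_of_set Y) (\<Union>m\<in>B. {y\<in>Y. (LEAST k. y \<in> W k) = m})" for B
    by blast
  moreover have "(\<Union>m\<in>B. {y\<in>Y. (LEAST k. y \<in> W k) = m}) = Y \<inter> (\<lambda>y. LEAST k. y \<in> W k) -` B" for B
    by auto
  ultimately show ?thesis
    by (simp add: continuous_on_open_gen continuous_on_open_vimage continuous_openin_preimage_eq)
qed

text \<open>Representatives of different labels have to be different points, because each of them
  will receive a clopen cell of its own.\<close>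

lemma injective_choice_avoiding_finite:
  fixes Q :: "nat \<Rightarrow> 'a \<Rightarrow> bool"
  assumes "\<And>v A. v < N \<Longrightarrow> finite A \<Longrightarrow> \<exists>x. x \<notin> A \<and> Q v x"
  shows "\<exists>f. inj_on f {..<N} \<and> (\<forall>v<N. Q v (f v))"
  using assms
proof (induction N)
  case (Suc N)
  then obtain f where f: "inj_on f {..<N}" "\<forall>v<N. Q v (f v)"
    by (metis less_Suc_eq)
  obtain x where x: "x \<notin> f ` {..<N}" "Q N x"
    using Suc.prems[of N "f ` {..<N}"] by auto
  have "inj_on (f(N := x)) {..<Suc N}"
    using f(1) x(1) by (auto simp: lessThan_Suc inj_on_fun_updI)
  then show ?case
    using f(2) x(2) by (metis fun_upd_apply less_Suc_eq)
qed auto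

text \<open>Turns Hausdorff convergence of fibres into convergence of both endpoints, the form in
  which it is used.\<close>

lemma hausdorff_dist_Icc_endpoints:
  fixes l u a b :: real
  assumes "l \<le> u" "a \<le> b"
  shows "\<bar>l - a\<bar> \<le> hausdorff_dist {l..u} {a..b}" "\<bar>u - b\<bar> \<le> hausdorff_dist {l..u} {a..b}"
proof -
  have le: "infdist t {c..d} \<le> (SUP s\<in>{a'..b'}. infdist s {c..d})"
    if "c \<le> d" "t \<in> {a'..b'}" for t a' b' c d :: real
  proof (rule cSUP_upper)
    have "infdist s {c..d} \<le> \<bar>a' - c\<bar> + \<bar>b' - c\<bar>" if "s \<in> {a'..b'}" for s
    proof -
      have "infdist s {c..d} \<le> dist s c" using \<open>c \<le> d\<close> by (intro infdist_le) auto
      then show ?thesis using that by (auto simp: dist_real_def)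
    qed
    then show "bdd_above ((\<lambda>s. infdist s {c..d}) ` {a'..b'})" by (meson bdd_aboveI2)
  qed (use that in auto)
  have ge: "c - t \<le> infdist t {c..d}" "t - d \<le> infdist t {c..d}" if "c \<le> d" for t c d :: real
  proof -
    have ne: "{c..d} \<noteq> {}" using that by auto
    show "c - t \<le> infdist t {c..d}" "t - d \<le> infdist t {c..d}"
      unfolding infdist_notempty[OF ne]
      by (rule cINF_greatest[OF ne], auto simp: dist_real_def)+
  qed
  show "\<bar>l - a\<bar> \<le> hausdorff_dist {l..u} {a..b}"
    using le[OF assms(2), of l l u] le[OF assms(1), of a a b] ge(1)[OF assms(2), of l]
      ge(1)[OF assms(1), of a] assms
    by (auto simp: hausdorff_dist_def)
  show "\<bar>u - b\<bar> \<le> hausdorff_dist {l..u} {a..b}"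
    using le[OF assms(2), of u l u] le[OF assms(1), of b a b] ge(2)[OF assms(2), of u]
      ge(2)[OF assms(1), of b] assms
    by (auto simp: hausdorff_dist_def)
qed

lemma convex_combination_bounds:
  fixes a b s :: real
  assumes "a \<le> b" "0 \<le> s" "s \<le> 1"
  shows "a \<le> (1 - s) * a + s * b" "(1 - s) * a + s * b \<le> b"
proof -
  have "0 \<le> s * (b - a)" "0 \<le> (1 - s) * (b - a)" using assms by auto
  then show "a \<le> (1 - s) * a + s * b" "(1 - s) * a + s * b \<le> b" by (auto simp: algebra_simps)
qed

lemma convex_combination_diff:
  fixes a b a' b' s d :: real
  assumes "\<bar>a - a'\<bar> \<le> d" "\<bar>b - b'\<bar> \<le> d" "0 \<le> s" "s \<le> 1"
  shows "\<bar>((1 - s) * a + s * b) - ((1 - s) * a' + s * b')\<bar> \<le> d"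
proof -
  have "((1 - s) * a + s * b) - ((1 - s) * a' + s * b') = (1 - s) * (a - a') + s * (b - b')"
    by (simp add: algebra_simps)
  also have "\<bar>\<dots>\<bar> \<le> (1 - s) * \<bar>a - a'\<bar> + s * \<bar>b - b'\<bar>"
    using assms by (intro order_trans[OF abs_triangle_ineq]) (simp add: abs_mult)
  also have "\<dots> \<le> (1 - s) * d + s * d"
    using assms by (intro add_mono mult_left_mono) auto
  finally show ?thesis by (simp add: algebra_simps)
qed

lemma pred_mod_dvd:
  fixes d N :: nat
  assumes "d dvd N" "0 < N"
  shows "(N - 1) mod d = d - 1"
proof -
  have "Suc (N - 1) mod d = 0" using assms by simp
  then have "Suc ((N - 1) mod d) = d" by (simp add: mod_Suc split: if_splits)
  then show ?thesis by simp
qed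

section \<open>Topology of the base, approximation of fibres, compactness of the fence\<close>

locale fence_system =
  fixes Y :: "'a::metric_space set" and fL fU :: "'a \<Rightarrow> real"
  assumes fraisse: "fraisse_fence Y fL fU"
begin

abbreviation len :: "'a \<Rightarrow> real" where "len y \<equiv> fU y - fL y"

lemma compact_Y: "compact Y" and Y_nonempty: "Y \<noteq> {}"
  and Y_connected: "\<And>C. C \<subseteq> Y \<Longrightarrow> connected C \<Longrightarrow> \<exists>a. C \<subseteq> {a}"
  and fence_bounds: "\<And>y. y \<in> Y \<Longrightarrow> 0 \<le> fL y \<and> fL y \<le> fU y \<and> fU y \<le> 1"
  and lower_open: "\<And>a. openin (top_of_set Y) {y\<in>Y. a < fL y}"
  and upper_open: "\<And>a. openin (top_of_set Y) {y\<in>Y. fU y < a}"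
  using fraisse unfolding fraisse_fence_def fence_data_def cantor_space_def
    lower_semicontinuous_on_def upper_semicontinuous_on_def by simp_all

text \<open>Compactness upgrades total disconnectedness to zero-dimensionality: a connected set has
  at most one point, so it cannot meet both \<open>{y}\<close> and the complement of
  \<open>U\<close>, and the cut-wire-fence theorem separates these closed sets.\<close>

lemma clopen_neighbourhood:
  assumes "openin (top_of_set Y) U" "y \<in> U"
  obtains V where "openin (top_of_set Y) V" "closedin (top_of_set Y) V" "y \<in> V" "V \<subseteq> U"
proof -
  have yY: "y \<in> Y" using assms openin_imp_subset by blast
  have "separated_between (top_of_set Y) {y} (Y - U)"
  proof (rule cut_wire_fence_theorem)
    show "compact_space (top_of_set Y)" using compact_Y by (simp add: compact_space_subtopology)
    show "Hausdorff_space (top_of_set Y)" by (simp add: Hausdorff_space_subtopology)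
    show "closedin (top_of_set Y) {y}" using yY by (simp add: closedin_closed_eq closed_subset)
    show "closedin (top_of_set Y) (Y - U)" using assms by auto
    fix C assume "connectedin (top_of_set Y) C"
    then obtain a where "C \<subseteq> {a}"
      using Y_connected[of C] by (metis connectedin_iff_connected connectedin_subtopology)
    then show "disjnt C {y} \<or> disjnt C (Y - U)" using assms by (auto simp: disjnt_iff)
  qed
  then obtain V where "closedin (top_of_set Y) V" "openin (top_of_set Y) V" "{y} \<subseteq> V"
      "Y - U \<subseteq> topspace (top_of_set Y) - V"
    unfolding separated_between by blast
  moreover have "V \<subseteq> U"
    using calculation openin_imp_subset[OF calculation(2)] by auto
  ultimately show thesis using that by blast
qed

text \<open>The approximation property of a Fraisse fence enters only here. The case
  \<open>a = b\<close> supplies the short fibres and the point targets of the density argument; the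
  set \<open>A\<close> leaves room for an injective choice.\<close>

lemma fibre_approximation:
  assumes z: "z \<in> Y" "fL z \<le> a" "a \<le> b" "b \<le> fU z"
    and U: "openin (top_of_set Y) U" "z \<in> U" and "0 < d" "finite A"
  obtains x where "x \<in> U" "x \<notin> A" "x \<in> Y" "fL x < fU x" "\<bar>fL x - a\<bar> < d" "\<bar>fU x - b\<bar> < d"
proof -
  have "{a..b} \<noteq> {} \<and> compact {a..b} \<and> connected {a..b} \<and> {a..b} \<subseteq> fence_fibre fL fU z"
    using z by (auto simp: fence_fibre_def)
  then obtain yk where yk: "\<And>k. yk k \<in> Y \<and> yk k \<noteq> z \<and> fL (yk k) < fU (yk k)"
    and lim: "yk \<longlonglongrightarrow> z"
    and haus: "(\<lambda>k. hausdorff_dist (fence_fibre fL fU (yk k)) {a..b}) \<longlonglongrightarrow> 0"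
    using fraisse z(1) unfolding fraisse_fence_def by meson
  obtain G where G: "open G" "U = Y \<inter> G"
    using U(1) by (auto simp: openin_open)
  \<comment> \<open>If \<open>z\<close> lies in \<open>A\<close> it need not be removed, since
    \<open>yk k \<noteq> z\<close>; removing only the other points leaves a neighbourhood of
    \<open>z\<close>.\<close>
  have "open (G - (A - {z}))" "z \<in> G - (A - {z})"
    using G U \<open>finite A\<close> by (auto intro: open_Diff finite_imp_closed)
  then have ev1: "\<forall>\<^sub>F k in sequentially. yk k \<in> G - (A - {z})"
    using lim topological_tendstoD by blast
  have ev2: "\<forall>\<^sub>F k in sequentially. hausdorff_dist (fence_fibre fL fU (yk k)) {a..b} < d"
    using haus \<open>0 < d\<close> order_tendstoD(2) by blast
  obtain k where k: "yk k \<in> G - (A - {z})" "hausdorff_dist (fence_fibre fL fU (yk k)) {a..b} < d"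
    using eventually_happens'[OF _ eventually_conj[OF ev1 ev2]] by auto
  have "fence_fibre fL fU (yk k) = {fL (yk k)..fU (yk k)}"
    by (auto simp: fence_fibre_def)
  then have "\<bar>fL (yk k) - a\<bar> < d" "\<bar>fU (yk k) - b\<bar> < d"
    using hausdorff_dist_Icc_endpoints[of "fL (yk k)" "fU (yk k)" a b] k(2) yk[of k] z(3)
    by (auto simp: less_imp_le)
  then show thesis
    using that[of "yk k"] k(1) yk[of k] G by blast
qed

lemma eventually_fL_greater:
  assumes "\<And>n. x n \<in> Y" "x \<longlonglongrightarrow> y" "y \<in> Y" "a < fL y"
  shows "\<forall>\<^sub>F n in sequentially. a < fL (x n)"
proof -
  obtain G where G: "open G" "{y\<in>Y. a < fL y} = Y \<inter> G"
    using lower_open[of a] by (auto simp: openin_open)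
  then have "y \<in> G" using assms by auto
  then have "\<forall>\<^sub>F n in sequentially. x n \<in> G" using assms(2) G(1) topological_tendstoD by blast
  then show ?thesis by eventually_elim (use G assms(1) in blast)
qed

lemma eventually_fU_less:
  assumes "\<And>n. x n \<in> Y" "x \<longlonglongrightarrow> y" "y \<in> Y" "fU y < a"
  shows "\<forall>\<^sub>F n in sequentially. fU (x n) < a"
proof -
  obtain G where G: "open G" "{y\<in>Y. fU y < a} = Y \<inter> G"
    using upper_open[of a] by (auto simp: openin_open)
  then have "y \<in> G" using assms by auto
  then have "\<forall>\<^sub>F n in sequentially. x n \<in> G" using assms(2) G(1) topological_tendstoD by blast
  then show ?thesis by eventually_elim (use G assms(1) in blast)
qed

text \<open>Semicontinuity is what preserves the two inequalities defining the fence under limits;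
  the bounds 0 and 1 supply convergent subsequences.\<close>

lemma compact_fence: "compact (fence Y fL fU)"
proof -
  have "\<exists>l\<in>fence Y fL fU. \<exists>r::nat\<Rightarrow>nat. strict_mono r \<and> (f \<circ> r) \<longlonglongrightarrow> l"
    if f: "\<forall>n. f n \<in> fence Y fL fU" for f :: "nat \<Rightarrow> 'a \<times> real"
  proof -
    have b: "fst (f n) \<in> Y" "fL (fst (f n)) \<le> snd (f n)" "snd (f n) \<le> fU (fst (f n))" for n
      using f[rule_format, of n] by (auto simp: fence_def)
    have "seq_compact (Y \<times> {0..1::real})"
      using compact_Y by (simp add: compact_Times compact_imp_seq_compact)
    moreover have "\<forall>n. f n \<in> Y \<times> {0..1}"
      using b fence_bounds by (metis atLeastAtMost_iff mem_Times_iff order_trans)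
    ultimately obtain l r where l: "l \<in> Y \<times> {0..1}" "strict_mono r" "(f \<circ> r) \<longlonglongrightarrow> l"
      by (meson seq_compactE)
    have l1: "(\<lambda>n. fst (f (r n))) \<longlonglongrightarrow> fst l" "(\<lambda>n. snd (f (r n))) \<longlonglongrightarrow> snd l"
      using tendsto_fst[OF l(3)] tendsto_snd[OF l(3)] by (auto simp: o_def)
    have lY: "fst l \<in> Y" using l by auto
    have "fL (fst l) \<le> snd l"
    proof (rule ccontr)
      assume "\<not> fL (fst l) \<le> snd l"
      then obtain a where a: "snd l < a" "a < fL (fst l)" using dense not_le by metis
      have "\<forall>\<^sub>F n in sequentially. a < snd (f (r n))"
        using eventually_fL_greater[OF _ l1(1) lY a(2)] b by (auto elim!: eventually_mono intro: less_le_trans)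
      moreover have "\<forall>\<^sub>F n in sequentially. snd (f (r n)) < a"
        using l1(2) a(1) order_tendstoD(2) by blast
      ultimately have "\<forall>\<^sub>F n::nat in sequentially. False" by eventually_elim simp
      then show False by simp
    qed
    moreover have "snd l \<le> fU (fst l)"
    proof (rule ccontr)
      assume "\<not> snd l \<le> fU (fst l)"
      then obtain a where a: "fU (fst l) < a" "a < snd l" using dense not_le by metis
      have "\<forall>\<^sub>F n in sequentially. snd (f (r n)) < a"
        using eventually_fU_less[OF _ l1(1) lY a(1)] b by (auto elim!: eventually_mono intro: le_less_trans)
      moreover have "\<forall>\<^sub>F n in sequentially. a < snd (f (r n))"
        using l1(2) a(2) order_tendstoD(1) by blast
      ultimately have "\<forall>\<^sub>F n::nat in sequentially. False" by eventually_elim simp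
      then show False by simp
    qed
    ultimately have "l \<in> fence Y fL fU" using lY by (cases l) (auto simp: fence_def)
    then show ?thesis using l by blast
  qed
  then show ?thesis
    unfolding compact_eq_seq_compact_metric seq_compact_def by blast
qed

section \<open>Affine positions in fibres\<close>

text \<open>Clamped because fibres over a cell may stick out of the chosen fibre. For such a point
  \<open>aff z (nrm z t)\<close> is the nearest endpoint.\<close>

definition nrm :: "'a \<Rightarrow> real \<Rightarrow> real" where
  "nrm z t = max 0 (min 1 ((t - fL z) / len z))"

definition aff :: "'a \<Rightarrow> real \<Rightarrow> real" where
  "aff z s = fL z + s * len z"

text \<open>One-sided on purpose: fibres close to a given one stay in a neighbourhood of it but may
  be much shorter.\<close>

definition near :: "real \<Rightarrow> 'a \<Rightarrow> 'a \<Rightarrow> bool" where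
  "near d y z \<longleftrightarrow> fL z - d \<le> fL y \<and> fU y \<le> fU z + d"

definition good :: "real \<Rightarrow> 'a \<Rightarrow> 'a \<Rightarrow> bool" where
  "good e y z \<longleftrightarrow> near (e * len z) y z \<or> len y \<le> e * len z"

definition level :: "nat \<Rightarrow> ('a \<Rightarrow> nat) \<Rightarrow> (nat \<Rightarrow> 'a) \<Rightarrow> bool" where
  "level P c z \<longleftrightarrow> 0 < P \<and> continuous_on Y c \<and> (\<forall>y\<in>Y. c y < P) \<and>
     (\<forall>w<P. z w \<in> Y \<and> c (z w) = w \<and> fL (z w) < fU (z w))"

lemma nrm_range: "0 \<le> nrm z t" "nrm z t \<le> 1"
  by (auto simp: nrm_def)

lemma nrm_mono: "len z > 0 \<Longrightarrow> s \<le> t \<Longrightarrow> nrm z s \<le> nrm z t"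
  unfolding nrm_def by (intro max.mono min.mono order_refl divide_right_mono) auto

lemma nrm_aff: "len z > 0 \<Longrightarrow> 0 \<le> s \<Longrightarrow> s \<le> 1 \<Longrightarrow> nrm z (aff z s) = s"
  by (simp add: nrm_def aff_def)

lemma aff_range:
  assumes "len z > 0" "0 \<le> s" "s \<le> 1"
  shows "fL z \<le> aff z s" "aff z s \<le> fU z"
proof -
  show "fL z \<le> aff z s" using assms by (simp add: aff_def)
  have "s * len z \<le> 1 * len z" using assms by (intro mult_right_mono) auto
  then show "aff z s \<le> fU z" by (simp add: aff_def)
qed

lemma nrm_lipschitz:
  assumes "len z > 0"
  shows "\<bar>nrm z s - nrm z t\<bar> \<le> \<bar>s - t\<bar> / len z"
proof -
  have "\<bar>nrm z s - nrm z t\<bar> \<le> \<bar>(s - fL z) / len z - (t - fL z) / len z\<bar>"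
    by (auto simp: nrm_def)
  also have "\<dots> = \<bar>s - t\<bar> / len z"
    using assms by (simp add: diff_divide_distrib[symmetric])
  finally show ?thesis .
qed

lemma clamp_close:
  assumes x: "len x > 0" and d: "0 \<le> d" and t: "fL x - d \<le> t" "t \<le> fU x + d"
  shows "\<bar>aff x (nrm x t) - t\<bar> \<le> d"
proof -
  define s where "s = (t - fL x) / len x"
  have s: "t = fL x + s * len x" using x by (simp add: s_def)
  have n: "nrm x t = max 0 (min 1 s)" by (simp add: nrm_def s_def)
  consider "s < 0" | "0 \<le> s \<and> s \<le> 1" | "1 < s" by linarith
  then show ?thesis
  proof cases
    case 1
    then have "s * len x \<le> 0" using x by (intro mult_nonpos_nonneg) auto
    moreover have "aff x (nrm x t) = fL x" using 1 n by (simp add: aff_def)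
    ultimately show ?thesis using s t by auto
  next
    case 2
    then have "aff x (nrm x t) = t" using n s by (simp add: aff_def)
    then show ?thesis using d by simp
  next
    case 3
    then have "1 * len x \<le> s * len x" using x by (intro mult_right_mono) auto
    moreover have "aff x (nrm x t) = fU x" using 3 n by (simp add: aff_def)
    ultimately show ?thesis using s t by auto
  qed
qed

text \<open>If the fibre of \<open>y\<close> almost lies in that of \<open>x\<close>, clamping moves
  positions by at most \<open>e\<close> and unclamped positions are affine. If it is short compared
  with that of \<open>x\<close>, all positions involved differ by at most \<open>e\<close>.\<close>

lemma good_almost_affine:
  assumes x: "len x > 0" and y: "fL y \<le> fU y" and g: "good e y x" and e: "0 \<le> e" and s: "0 \<le> s" "s \<le> 1"
  shows "\<bar>nrm x (aff y s) - ((1 - s) * nrm x (fL y) + s * nrm x (fU y))\<bar> \<le> 2 * e"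
proof -
  have aff: "aff y s = (1 - s) * fL y + s * fU y" by (simp add: aff_def algebra_simps)
  have r: "fL y \<le> aff y s" "aff y s \<le> fU y"
    unfolding aff using convex_combination_bounds[OF y s] by auto
  have tri: "\<bar>a - b\<bar> \<le> 2 * e" if "\<bar>a - c\<bar> \<le> e" "\<bar>b - c\<bar> \<le> e" for a b c :: real
    using that by linarith
  from g consider "near (e * len x) y x" | "len y \<le> e * len x" by (auto simp: good_def)
  then show ?thesis
  proof cases
    case 1
    have *: "\<bar>nrm x t - (t - fL x) / len x\<bar> \<le> e" if "fL y \<le> t" "t \<le> fU y" for t
    proof -
      have "\<bar>aff x (nrm x t) - t\<bar> \<le> e * len x"
        using 1 that x e by (intro clamp_close) (auto simp: near_def)
      moreover have "aff x (nrm x t) - t = (nrm x t - (t - fL x) / len x) * len x"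
        using x by (simp add: aff_def field_simps)
      ultimately have "\<bar>nrm x t - (t - fL x) / len x\<bar> * len x \<le> e * len x"
        using x by (simp add: abs_mult)
      then show ?thesis using x by simp
    qed
    have "\<bar>((1 - s) * nrm x (fL y) + s * nrm x (fU y)) -
        ((1 - s) * ((fL y - fL x) / len x) + s * ((fU y - fL x) / len x))\<bar> \<le> e"
      using *[of "fL y"] *[of "fU y"] y s by (intro convex_combination_diff) auto
    moreover have "(1 - s) * ((fL y - fL x) / len x) + s * ((fU y - fL x) / len x) = (aff y s - fL x) / len x"
    proof -
      have "(1 - s) * (fL y - fL x) + s * (fU y - fL x) = aff y s - fL x"
        unfolding aff by (simp add: algebra_simps)
      then show ?thesis by (metis add_divide_distrib times_divide_eq_right)
    qed
    ultimately have "\<bar>((1 - s) * nrm x (fL y) + s * nrm x (fU y)) - (aff y s - fL x) / len x\<bar> \<le> e"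
      by simp
    from tri[OF *[OF r] this] show ?thesis .
  next
    case 2
    have m: "nrm x (fL y) \<le> nrm x (aff y s)" "nrm x (aff y s) \<le> nrm x (fU y)"
      using r x by (auto intro: nrm_mono)
    have "\<bar>nrm x (fU y) - nrm x (fL y)\<bar> \<le> \<bar>len y\<bar> / len x" by (rule nrm_lipschitz[OF x])
    also have "\<dots> \<le> e" using 2 x y by (simp add: divide_le_eq)
    finally have "nrm x (fU y) - nrm x (fL y) \<le> e" by simp
    moreover have "nrm x (fL y) \<le> nrm x (fU y)" using m by linarith
    ultimately show ?thesis
      using m convex_combination_bounds[OF \<open>nrm x (fL y) \<le> nrm x (fU y)\<close> s] e by linarith
  qed
qed

lemma openin_label:
  assumes "continuous_on Y (c :: 'a \<Rightarrow> nat)"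
  shows "openin (top_of_set Y) {y\<in>Y. c y = w}"
proof -
  have "openin (top_of_set Y) (Y \<inter> c -` {w})"
    using assms by (intro continuous_openin_preimage_gen) (auto simp: open_discrete)
  moreover have "Y \<inter> c -` {w} = {y\<in>Y. c y = w}" by auto
  ultimately show ?thesis by simp
qed

section \<open>Refining labelled partitions\<close>

text \<open>Around a degenerate fibre there need not be any fibre comparable in length with the hull of
  the fibres nearby. There one picks a nondegenerate fibre first and shrinks the neighbourhood
  relative to its length: this is the reason for the second alternative in \<open>good\<close>.\<close>
lemma local_model:
  assumes y: "y \<in> Y" and U0: "openin (top_of_set Y) U0" "y \<in> U0" and e: "0 < e" and h: "0 < h"
  obtains z U where "z \<in> U0" "z \<in> Y" "fL z < fU z" "y \<in> U" "U \<subseteq> U0"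
    "openin (top_of_set Y) U" "closedin (top_of_set Y) U"
    "\<And>x. x \<in> U \<Longrightarrow> dist x z < e \<and> near h x z \<and> good e x z"
proof -
  \<comment> \<open>For nondegenerate \<open>y\<close> the bound \<open>len y / 4\<close> forces
    \<open>len y \<le> 2 * len z\<close>, which converts the bound \<open>e * len y / 8\<close> into
    one relative to \<open>len z\<close>.\<close>
  define d where "d = (if len y > 0 then min (h/2) (min (len y / 4) (e * len y / 8)) else h/2)"
  have "d > 0" using e h by (auto simp: d_def)
  have "openin (top_of_set Y) (U0 \<inter> ball y (e/2))"
    using U0 by (metis Int_commute openin_Int_open open_ball)
  then obtain z where z: "z \<in> U0 \<inter> ball y (e/2)" "z \<in> Y" "fL z < fU z" "\<bar>fL z - fL y\<bar> < d" "\<bar>fU z - fU y\<bar> < d"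
    using fibre_approximation[of y "fL y" "fU y" "U0 \<inter> ball y (e/2)" d "{}"] y U0 e \<open>d > 0\<close>
      fence_bounds[OF y] by auto
  define d' where "d' = min d (e * len z / 2)"
  have "d' > 0" using \<open>d > 0\<close> z(3) e by (auto simp: d'_def)
  have "openin (top_of_set Y) (U0 \<inter> ball y (e/2) \<inter> {x\<in>Y. fL y - d' < fL x} \<inter> {x\<in>Y. fU x < fU y + d'})"
    (is "openin _ ?O")
    by (intro openin_Int[OF openin_Int] lower_open upper_open
        \<open>openin (top_of_set Y) (U0 \<inter> ball y (e/2))\<close>)
  moreover have "y \<in> ?O" using y U0 e \<open>d' > 0\<close> by auto
  ultimately obtain U where U: "openin (top_of_set Y) U" "closedin (top_of_set Y) U" "y \<in> U" "U \<subseteq> ?O"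
    by (rule clopen_neighbourhood)
  show thesis
  proof (rule that[of z U])
    fix x assume "x \<in> U"
    then have x: "x \<in> ball y (e/2)" "x \<in> Y" "fL y - d' < fL x" "fU x < fU y + d'" using U by auto
    have "dist x z < e"
      using x(1) z(1) dist_triangle2[of x z y] by (auto simp: dist_commute)
    moreover have "2 * d \<le> h" "d' \<le> d" by (auto simp: d_def d'_def)
    then have "near h x z" using x z by (auto simp: near_def)
    moreover have "good e x z"
    proof (cases "len y > 0")
      case True
      then have "d = min (h/2) (min (len y / 4) (e * len y / 8))" by (simp add: d_def)
      then have "d \<le> len y / 4" "d \<le> e * len y / 8" by linarith+
      moreover have "len y \<le> 2 * len z" using \<open>d \<le> len y / 4\<close> z by auto
      then have "e * len y \<le> 2 * (e * len z)"
        using e by (metis less_imp_le mult.left_commute mult_left_mono)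
      ultimately have "2 * d \<le> e * len z" using \<open>d > 0\<close> by linarith
      then show ?thesis using x z \<open>d' \<le> d\<close> by (auto simp: good_def near_def)
    next
      case False
      then have "len y = 0" using fence_bounds[OF y] by auto
      moreover have "2 * d' \<le> e * len z" unfolding d'_def by linarith
      ultimately show ?thesis using x by (auto simp: good_def)
    qed
    ultimately show "dist x z < e \<and> near h x z \<and> good e x z" by blast
  qed (use z U in auto)
qed

text \<open>Compactness leaves finitely many local models; each neighbourhood is taken inside one
  cell of \<open>c\<close>, so that it can be used to form a subcell.\<close>

lemma finite_local_models:
  assumes "level P c z" and e: "0 < e" and h: "0 < h"
  shows "\<exists>(R::nat) zz U. (\<forall>j<R. zz j \<in> Y \<and> fL (zz j) < fU (zz j) \<and>
      openin (top_of_set Y) (U j) \<and> closedin (top_of_set Y) (U j) \<and>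
      (\<forall>x\<in>U j. c x = c (zz j) \<and> dist x (zz j) < e \<and> near h x (zz j) \<and> good e x (zz j))) \<and>
    (\<forall>y\<in>Y. \<exists>j<R. y \<in> U j)"
proof -
  have cont: "continuous_on Y c" using assms by (auto simp: level_def)
  have "\<forall>y\<in>Y. \<exists>z U. z \<in> Y \<and> fL z < fU z \<and> y \<in> U \<and> openin (top_of_set Y) U \<and> closedin (top_of_set Y) U \<and>
     (\<forall>x\<in>U. c x = c z \<and> dist x z < e \<and> near h x z \<and> good e x z)" (is "\<forall>y\<in>Y. \<exists>z U. ?L y z U")
  proof
    fix y assume y: "y \<in> Y"
    have "y \<in> {x\<in>Y. c x = c y}" using y by simp
    then obtain z U where "z \<in> {x\<in>Y. c x = c y}" "z \<in> Y" "fL z < fU z" "y \<in> U" "U \<subseteq> {x\<in>Y. c x = c y}"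
        "openin (top_of_set Y) U" "closedin (top_of_set Y) U"
        "\<And>x. x \<in> U \<Longrightarrow> dist x z < e \<and> near h x z \<and> good e x z"
      by (rule local_model[OF y openin_label[OF cont, of "c y"] _ e h]) blast
    then have "?L y z U" by auto
    then show "\<exists>z U. ?L y z U" by blast
  qed
  then obtain Z UU where ZU: "\<And>y. y \<in> Y \<Longrightarrow> ?L y (Z y) (UU y)" by metis
  have "\<forall>C. (\<forall>c\<in>C. openin (top_of_set Y) c) \<and> Y \<subseteq> \<Union>C \<longrightarrow> (\<exists>D\<subseteq>C. finite D \<and> Y \<subseteq> \<Union>D)"
    using compact_Y unfolding compact_eq_openin_cover by simp
  moreover have "(\<forall>c\<in>UU ` Y. openin (top_of_set Y) c) \<and> Y \<subseteq> \<Union>(UU ` Y)" using ZU by auto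
  ultimately obtain D where D: "D \<subseteq> UU ` Y" "finite D" "Y \<subseteq> \<Union>D" by meson
  then obtain B where B: "B \<subseteq> Y" "finite B" "D = UU ` B" by (meson finite_subset_image)
  obtain g where "bij_betw g {0..<card B} B" using B ex_bij_betw_nat_finite by blast
  then have g: "g ` {0..<card B} = B" by (simp add: bij_betw_def)
  then have gY: "g j \<in> Y" if "j < card B" for j using B that by force
  have "\<exists>j<card B. y \<in> UU (g j)" if y: "y \<in> Y" for y
  proof -
    obtain b where "b \<in> B" "y \<in> UU b" using D B y by auto
    moreover then obtain j where "j < card B" "g j = b"
      using g by (metis atLeastLessThan_iff imageE)
    ultimately show ?thesis by auto
  qed
  then show ?thesis
    using ZU gY by (intro exI[of _ "card B"] exI[of _ "Z \<circ> g"] exI[of _ "UU \<circ> g"]) simp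
qed

definition models :: "real \<Rightarrow> ('a \<Rightarrow> nat) \<Rightarrow> (nat \<Rightarrow> 'a) \<Rightarrow> bool" where
  "models e c z \<longleftrightarrow> (\<forall>y\<in>Y. dist y (z (c y)) \<le> e \<and> near e y (z (c y)) \<and> good e y (z (c y)))"

text \<open>Comparing all pairs \<open>w\<close>, \<open>w'\<close> makes relative positions depend
  on the digit \<open>i\<close> alone, up to \<open>e\<close>. The last clause concerns the blocks
  of the first and last digit, which contain the labels 0 and \<open>P' - 1\<close> where adding 1
  wraps around.\<close>

definition refines :: "real \<Rightarrow> nat \<Rightarrow> ('a \<Rightarrow> nat) \<Rightarrow> (nat \<Rightarrow> 'a) \<Rightarrow> nat \<Rightarrow> ('a \<Rightarrow> nat) \<Rightarrow> (nat \<Rightarrow> 'a) \<Rightarrow> bool"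
  where "refines e P c z P' c' z' \<longleftrightarrow> P dvd P' \<and> (\<forall>y\<in>Y. c' y mod P = c y) \<and>
    (\<forall>y\<in>Y. near (e * len (z (c y))) y (z' (c' y))) \<and>
    (\<forall>w<P. \<forall>w'<P. \<forall>i<P' div P.
       \<bar>nrm (z w) (fL (z' (w + P * i))) - nrm (z w') (fL (z' (w' + P * i)))\<bar> \<le> e \<and>
       \<bar>nrm (z w) (fU (z' (w + P * i))) - nrm (z w') (fU (z' (w' + P * i)))\<bar> \<le> e) \<and>
    (\<forall>v<P'. v < P \<or> P' - P \<le> v \<longrightarrow> len (z' v) \<le> e)"

text \<open>All cells must show the same pattern of subfibres, but a local model lives in one cell
  only. So each model owns a digit between 1 and \<open>R\<close>: in its own cell the subfibre
  approximates the model, in every other cell it approximates an affine copy at the same relative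
  position. The label combining this digit with the model's own cell takes the bulk of the points;
  otherwise a label only gets a small neighbourhood of its representative. The remaining digits are
  idle and get nearly degenerate fibres; \<open>q \<ge> R + 2\<close> makes the first and the last
  digit idle.\<close>

lemma refine_level:
  assumes lev: "level P c z" and e: "0 < e"
  shows "\<exists>R. \<forall>q\<ge>R + 2. \<exists>c' z'. level (P * q) c' z' \<and> models e c' z' \<and> refines e P c z (P * q) c' z'"
proof -
  have P: "0 < P" and cont: "continuous_on Y c" and cP: "\<And>y. y \<in> Y \<Longrightarrow> c y < P"
    and zY: "\<And>w. w < P \<Longrightarrow> z w \<in> Y" and cz: "\<And>w. w < P \<Longrightarrow> c (z w) = w"
    and lz: "\<And>w. w < P \<Longrightarrow> 0 < len (z w)"
    using lev by (auto simp: level_def)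
  \<comment> \<open>An absolute error \<open>h\<close> is at most \<open>e\<close> relative to each
    of the finitely many old fibres.\<close>
  define h where "h = Min (insert e ((\<lambda>w. e * len (z w)) ` {..<P}))"
  have h0: "0 < h" unfolding h_def using e lz by (subst Min_gr_iff) auto
  have he: "h \<le> e" unfolding h_def by (rule Min_le) auto
  have hz: "h \<le> e * len (z w)" if "w < P" for w unfolding h_def using that by (intro Min_le) auto
  have e4: "0 < e/4" and h2: "0 < h/2" using e h0 by auto
  obtain R :: nat and zz U where local: "\<forall>j<R. zz j \<in> Y \<and> fL (zz j) < fU (zz j) \<and>
      openin (top_of_set Y) (U j) \<and> closedin (top_of_set Y) (U j) \<and>
      (\<forall>x\<in>U j. c x = c (zz j) \<and> dist x (zz j) < e/4 \<and> near (h/2) x (zz j) \<and> good (e/4) x (zz j))"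
    and cover_all: "\<forall>y\<in>Y. \<exists>j<R. y \<in> U j"
    using finite_local_models[OF lev e4 h2] by blast
  have zz: "zz j \<in> Y \<and> fL (zz j) < fU (zz j)"
    and Uclopen: "openin (top_of_set Y) (U j) \<and> closedin (top_of_set Y) (U j)" if "j < R" for j
    using local that by blast+
  have U: "c x = c (zz j) \<and> dist x (zz j) < e/4 \<and> near (h/2) x (zz j) \<and> good (e/4) x (zz j)"
    if "j < R" "x \<in> U j" for j x
    using local that by blast
  have Ucover: "\<exists>j<R. y \<in> U j" if "y \<in> Y" for y using cover_all that by blast
  \<comment> \<open>The error allowed when choosing \<open>z'\<close>: \<open>h/2\<close> keeps
    positions within \<open>e/2\<close>, a quarter of the length keeps \<open>z'\<close> at least
    half as long as the model, and the factor 1/16 leaves room in \<open>good\<close> beyond the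
    \<open>e/4\<close> already spent.\<close>
  define t where "t = Min (insert (h/2) ((\<lambda>j. min (len (zz j) / 4) (e * len (zz j) / 16)) ` {..<R}))"
  have t0: "0 < t" unfolding t_def using e h0 zz by (subst Min_gr_iff) auto
  have th: "t \<le> h/2" unfolding t_def by (rule Min_le) auto
  have tz: "t \<le> len (zz j) / 4" "t \<le> e * len (zz j) / 16" if "j < R" for j
  proof -
    have "t \<le> min (len (zz j) / 4) (e * len (zz j) / 16)"
      unfolding t_def using that by (intro Min_le) auto
    then show "t \<le> len (zz j) / 4" "t \<le> e * len (zz j) / 16" by linarith+
  qed
  show ?thesis
  proof (rule exI[of _ R], intro allI impI)
    fix q assume q: "R + 2 \<le> q"
    define N where "N = P * q"
    define own where "own i \<longleftrightarrow> 1 \<le> i \<and> i \<le> R" for i :: nat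
    define mine where "mine v \<longleftrightarrow> own (v div P) \<and> c (zz (v div P - 1)) = v mod P" for v
    define base where "base v = (if mine v then zz (v div P - 1) else z (v mod P))" for v
    \<comment> \<open>The relative position prescribed by digit \<open>i\<close>. For an idle digit
      both ends get position 0, so the target is a single point.\<close>
    define s where "s f i = (if own i then nrm (z (c (zz (i - 1)))) (f (zz (i - 1))) else 0)"
      for f :: "'a \<Rightarrow> real" and i
    define goal where "goal f v = (if mine v then f (zz (v div P - 1)) else aff (z (v mod P)) (s f (v div P)))"
      for f :: "'a \<Rightarrow> real" and v
    have own_zz: "zz (i - 1) \<in> Y" "fL (zz (i - 1)) < fU (zz (i - 1))" "c (zz (i - 1)) < P" if "own i" for i
      using zz[of "i - 1"] that cP[of "zz (i - 1)"] by (auto simp: own_def)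
    have s01: "0 \<le> s f i" "s f i \<le> 1" for f i
      using nrm_range by (auto simp: s_def)
    have sLU: "s fL i \<le> s fU i" for i
      using own_zz[of i] lz by (auto simp: s_def intro!: nrm_mono)
    have vP: "v mod P < P" for v using P by simp
    have base: "base v \<in> Y" "c (base v) = v mod P" for v
      using own_zz zY[OF vP] cz[OF vP] by (auto simp: base_def mine_def)
    have goal_range: "fL (base v) \<le> goal fL v" "goal fL v \<le> goal fU v" "goal fU v \<le> fU (base v)" for v
    proof -
      have "aff (z (v mod P)) (s fL (v div P)) \<le> aff (z (v mod P)) (s fU (v div P))"
        using sLU[of "v div P"] lz[OF vP, of v] by (auto simp: aff_def intro!: mult_right_mono)
      then show "fL (base v) \<le> goal fL v" "goal fL v \<le> goal fU v" "goal fU v \<le> fU (base v)"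
        using aff_range[OF lz[OF vP] s01] own_zz(2)[of "v div P"]
        by (auto simp: base_def goal_def mine_def)
    qed
    \<comment> \<open>The targets have exactly the prescribed positions, so cells differ in their
      patterns only by the approximation error.\<close>
    have nrm_goal: "nrm (z (v mod P)) (goal f v) = s f (v div P)" for f v
    proof (cases "mine v")
      case True
      then show ?thesis by (simp add: goal_def s_def mine_def)
    next
      case False
      then show ?thesis using nrm_aff[OF lz[OF vP] s01] by (simp add: goal_def)
    qed
    define Q where "Q v x \<longleftrightarrow> x \<in> Y \<and> c x = v mod P \<and> dist x (base v) < e/4 \<and> fL x < fU x \<and>
        \<bar>fL x - goal fL v\<bar> < t \<and> \<bar>fU x - goal fU v\<bar> < t" for v x
    have "\<exists>x. x \<notin> A \<and> Q v x" if "v < N" "finite A" for v A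
    proof -
      have "openin (top_of_set Y) ({y\<in>Y. c y = v mod P} \<inter> ball (base v) (e/4))"
        using openin_label[OF cont] by (metis Int_commute openin_Int_open open_ball)
      moreover have "base v \<in> {y\<in>Y. c y = v mod P} \<inter> ball (base v) (e/4)"
        using base[of v] e by auto
      ultimately obtain x where "x \<in> {y\<in>Y. c y = v mod P} \<inter> ball (base v) (e/4)" "x \<notin> A" "x \<in> Y"
          "fL x < fU x" "\<bar>fL x - goal fL v\<bar> < t" "\<bar>fU x - goal fU v\<bar> < t"
        by (rule fibre_approximation[OF base(1)[of v] goal_range[of v] _ _ t0 \<open>finite A\<close>])
      then show ?thesis by (auto simp: dist_commute Q_def)
    qed
    then obtain z' where "inj_on z' {..<N} \<and> (\<forall>v<N. Q v (z' v))"
      using injective_choice_avoiding_finite[of N Q] by blast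
    then have inj: "inj_on z' {..<N}" and z': "\<And>v. v < N \<Longrightarrow> z' v \<in> Y \<and> c (z' v) = v mod P \<and>
        dist (z' v) (base v) < e/4 \<and> fL (z' v) < fU (z' v) \<and>
        \<bar>fL (z' v) - goal fL v\<bar> < t \<and> \<bar>fU (z' v) - goal fU v\<bar> < t"
      unfolding Q_def by blast+
    define r where "r v = min h (e * len (z' v))" for v
    \<comment> \<open>The other representatives are removed, so that no \<open>V v\<close> can claim
      a representative other than \<open>z' v\<close>.\<close>
    define nbhd where "nbhd v = {y\<in>Y. c y = v mod P} \<inter> (ball (z' v) e - z' ` ({..<N} - {v})) \<inter>
        {x\<in>Y. fL (z' v) - r v < fL x} \<inter> {x\<in>Y. fU x < fU (z' v) + r v}" for v
    have "\<exists>V. openin (top_of_set Y) V \<and> closedin (top_of_set Y) V \<and> z' v \<in> V \<and> V \<subseteq> nbhd v"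
      if v: "v < N" for v
    proof -
      have "0 < r v" using z'[OF v] h0 e by (auto simp: r_def)
      have "open (ball (z' v) e - z' ` ({..<N} - {v}))"
        by (intro open_Diff finite_imp_closed) auto
      then have "openin (top_of_set Y) ({y\<in>Y. c y = v mod P} \<inter> (ball (z' v) e - z' ` ({..<N} - {v})))"
        using openin_label[OF cont] by (metis Int_commute openin_Int_open)
      then have op: "openin (top_of_set Y) (nbhd v)"
        unfolding nbhd_def
        by (intro openin_Int[OF openin_Int] lower_open upper_open)
      have "z' v \<notin> z' ` ({..<N} - {v})"
        using inj v by (auto simp: inj_on_def)
      then have "z' v \<in> nbhd v" unfolding nbhd_def using z'[OF v] e \<open>0 < r v\<close> by auto
      then show ?thesis by (rule clopen_neighbourhood[OF op]) blast
    qed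
    then obtain V where
      Vclopen: "\<And>v. v < N \<Longrightarrow> openin (top_of_set Y) (V v) \<and> closedin (top_of_set Y) (V v) \<and> z' v \<in> V v"
      and V: "\<And>v. v < N \<Longrightarrow> V v \<subseteq> nbhd v"
      by metis
    \<comment> \<open>The sets \<open>V v\<close> come before the sets \<open>U j\<close>: the least
      index gives each representative its own label and leaves the rest of \<open>U j\<close> to
      digit \<open>j + 1\<close> in the cell of \<open>zz j\<close>.\<close>
    define W where "W k = (if k < N then V k else U (k - N))" for k
    define g where "g k = (if k < N then k else c (zz (k - N)) + P * (k - N + 1))" for k
    define k where "k y = (LEAST k. y \<in> W k)" for y
    define c' where "c' y = g (k y)" for y
    have cover: "\<exists>k<N + R. y \<in> W k" if y: "y \<in> Y" for y
    proof -
      obtain j where "j < R" "y \<in> U j" using Ucover[OF y] by blast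
      then show ?thesis by (intro exI[of _ "N + j"]) (auto simp: W_def)
    qed
    have contk: "continuous_on Y k" unfolding k_def
      using Vclopen Uclopen cover by (intro LEAST_clopen_cover_continuous[of "N + R"]) (auto simp: W_def)
    have contc': "continuous_on Y c'"
      unfolding c'_def by (rule continuous_on_compose2[OF _ contk, of UNIV]) auto
    have cases: "(\<exists>v<N. y \<in> V v \<and> c' y = v) \<or> (\<exists>j<R. y \<in> U j \<and> c' y = c (zz j) + P * (j + 1))"
      if y: "y \<in> Y" for y
    proof -
      have k: "k y < N + R" "y \<in> W (k y)"
        unfolding k_def using cover[OF y] by (metis (mono_tags, lifting) LeastI Least_le le_less_trans)+
      show ?thesis
      proof (cases "k y < N")
        case True
        then show ?thesis using k(2) by (auto simp: W_def c'_def g_def)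
      next
        case False
        then show ?thesis using k by (intro disjI2 exI[of _ "k y - N"]) (auto simp: W_def c'_def g_def)
      qed
    qed
    have c'z': "c' (z' v) = v" if v: "v < N" for v
    proof -
      have "z' v \<notin> V u" if "u < N" "u \<noteq> v" for u
        using V[OF that(1)] that v by (auto simp: nbhd_def)
      then have "k (z' v) = v"
        unfolding k_def using Vclopen[OF v] v
        by (intro Least_equality) (auto simp: W_def not_less[symmetric])
      then show ?thesis using v by (simp add: c'_def g_def)
    qed
    have dm: "(u + P * i) div P = i" "(u + P * i) mod P = u" if "u < P" for u i
      using that P by simp_all
    have own_v: "c (zz j) + P * (j + 1) < N" "(c (zz j) + P * (j + 1)) div P = j + 1"
      "(c (zz j) + P * (j + 1)) mod P = c (zz j)" if "j < R" for j
    proof -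
      have c: "c (zz j) < P" using zz[OF that] cP by blast
      have "c (zz j) + P * (j + 1) < P * (j + 2)" using c by simp
      also have "\<dots> \<le> N" unfolding N_def using q that by (intro mult_le_mono2) auto
      finally show "c (zz j) + P * (j + 1) < N" .
      show "(c (zz j) + P * (j + 1)) div P = j + 1" "(c (zz j) + P * (j + 1)) mod P = c (zz j)"
        by (rule dm[OF c])+
    qed
    have lev': "level N c' z'"
    proof -
      have "c' y < N" if "y \<in> Y" for y using cases[OF that] own_v by auto
      then show ?thesis using P q contc' z' c'z' unfolding level_def N_def by auto
    qed
    have c'mod: "c' y mod P = c y" if "y \<in> Y" for y
      using cases[OF that] own_v(3) U V by (fastforce simp: nbhd_def)
    have close: "dist y (z' (c' y)) \<le> e \<and> near h y (z' (c' y)) \<and> good e y (z' (c' y))" if y: "y \<in> Y" for y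
      using cases[OF y]
    proof (elim disjE exE conjE)
      fix v assume v: "v < N" "y \<in> V v" "c' y = v"
      then have "dist y (z' v) < e" "fL (z' v) - r v < fL y" "fU y < fU (z' v) + r v"
        using V[OF v(1)] by (auto simp: dist_commute nbhd_def)
      moreover have "r v \<le> h" "r v \<le> e * len (z' v)" unfolding r_def by linarith+
      ultimately show ?thesis using v(3) by (auto simp: near_def good_def)
    next
      fix j assume j: "j < R" "y \<in> U j" "c' y = c (zz j) + P * (j + 1)"
      define v where "v = c (zz j) + P * (j + 1)"
      have v: "v < N" "v div P = j + 1" "v mod P = c (zz j)" unfolding v_def by (rule own_v[OF j(1)])+
      have "mine v" using j(1) v by (simp add: mine_def own_def)
      then have "base v = zz j" "goal fL v = fL (zz j)" "goal fU v = fU (zz j)"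
        using v by (auto simp: base_def goal_def)
      then have zv: "dist (z' v) (zz j) < e/4" "\<bar>fL (z' v) - fL (zz j)\<bar> < t" "\<bar>fU (z' v) - fU (zz j)\<bar> < t"
        using z'[OF v(1)] by auto
      note Uj = U[OF j(1,2)]
      have "dist y (z' v) \<le> e"
        using Uj zv(1) dist_triangle2[of y "z' v" "zz j"] e by linarith
      moreover have "near h y (z' v)" using Uj zv th by (auto simp: near_def)
      moreover have "good e y (z' v)"
      proof -
        have "4 * t \<le> len (zz j)" using tz(1)[OF j(1)] by simp
        then have "len (zz j) \<le> 2 * len (z' v)" using zv(2,3) by auto
        then have "e * len (zz j) \<le> 2 * (e * len (z' v))"
          using e by (metis less_imp_le mult.left_commute mult_left_mono)
        moreover have "t \<le> e * len (zz j) / 16" by (rule tz(2)[OF j(1)])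
        moreover have "near (e / 4 * len (zz j)) y (zz j) \<or> len y \<le> e / 4 * len (zz j)"
          using Uj by (simp add: good_def)
        moreover have "e / 4 * len (zz j) = e * len (zz j) / 4" by simp
        moreover have "0 < e * len (z' v)" using e z'[OF v(1)] by simp
        ultimately show ?thesis
          unfolding good_def near_def using zv by (elim disjE) linarith+
      qed
      ultimately show ?thesis using j(3) v_def by simp
    qed
    have nearh: "near d y x" if "near h y x" "h \<le> d" for d y x using that by (auto simp: near_def)
    have pat: "\<bar>nrm (z (v mod P)) (f (z' v)) - s f (v div P)\<bar> \<le> e/2" if v: "v < N" and f: "\<bar>f (z' v) - goal f v\<bar> < t" for f v
    proof -
      have l: "0 < len (z (v mod P))" by (rule lz[OF vP])
      have "\<bar>nrm (z (v mod P)) (f (z' v)) - s f (v div P)\<bar> \<le> \<bar>f (z' v) - goal f v\<bar> / len (z (v mod P))"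
        using nrm_lipschitz[OF l, of "f (z' v)" "goal f v"] by (simp add: nrm_goal)
      also have "\<dots> \<le> e/2"
        using f l th hz[OF vP, of v] by (simp add: divide_le_eq)
      finally show ?thesis .
    qed
    have pattern: "\<bar>nrm (z w) (fL (z' (w + P * i))) - nrm (z w') (fL (z' (w' + P * i)))\<bar> \<le> e \<and>
       \<bar>nrm (z w) (fU (z' (w + P * i))) - nrm (z w') (fU (z' (w' + P * i)))\<bar> \<le> e"
      if "w < P" "w' < P" "i < q" for w w' i
    proof -
      have N: "u + P * i < N" "(u + P * i) mod P = u" "(u + P * i) div P = i" if "u < P" for u
      proof -
        have "u + P * i < P * (i + 1)" using that by simp
        also have "\<dots> \<le> N" unfolding N_def using \<open>i < q\<close> by (intro mult_le_mono2) auto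
        finally show "u + P * i < N" .
      qed (use that in auto)
      have "\<bar>nrm (z u) (fL (z' (u + P * i))) - s fL i\<bar> \<le> e/2" "\<bar>nrm (z u) (fU (z' (u + P * i))) - s fU i\<bar> \<le> e/2"
        if "u < P" for u
        using pat[OF N(1)[OF that], of fL] pat[OF N(1)[OF that], of fU] z'[OF N(1)[OF that]] N(2,3)[OF that]
        by auto
      from this[OF that(1)] this[OF that(2)] show ?thesis by linarith
    qed
    have small: "len (z' v) \<le> e" if v: "v < N" "v < P \<or> P * q - P \<le> v" for v
    proof -
      have "v div P = 0 \<or> R < v div P"
      proof (cases "v < P")
        case False
        then have "P * q - P \<le> v" using v by auto
        moreover have "P * q - P = P * (q - 1)" by (simp add: algebra_simps)
        ultimately have "P * (q - 1) \<le> v" by simp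
        then have "q - 1 \<le> v div P" using P by (simp add: less_eq_div_iff_mult_less_eq mult.commute)
        then show ?thesis using q by auto
      qed auto
      then have "\<not> own (v div P)" by (auto simp: own_def)
      then have "goal fL v = goal fU v" by (simp add: goal_def mine_def s_def)
      then show ?thesis using z'[OF v(1)] th he by linarith
    qed
    have "models e c' z'"
      unfolding models_def using close nearh he by blast
    moreover have "refines e P c z N c' z'"
      unfolding refines_def
    proof (intro conjI)
      show "P dvd N" by (simp add: N_def)
      have "N div P = q" using P by (simp add: N_def)
      then show "\<forall>w<P. \<forall>w'<P. \<forall>i<N div P.
         \<bar>nrm (z w) (fL (z' (w + P * i))) - nrm (z w') (fL (z' (w' + P * i)))\<bar> \<le> e \<and>
         \<bar>nrm (z w) (fU (z' (w + P * i))) - nrm (z w') (fU (z' (w' + P * i)))\<bar> \<le> e"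
        using pattern by auto
      show "\<forall>v<N. v < P \<or> N - P \<le> v \<longrightarrow> len (z' v) \<le> e"
        using small unfolding N_def by blast
      show "\<forall>y\<in>Y. near (e * len (z (c y))) y (z' (c' y))"
        using close nearh hz cP by blast
    qed (use c'mod in blast)
    ultimately show "\<exists>c' z'. level (P * q) c' z' \<and> models e c' z' \<and> refines e P c z (P * q) c' z'"
      using lev' unfolding N_def by blast
  qed
qed

end

section \<open>Towers of refinements along the odometer sequence\<close>

lemma odometer_seq_dvd:
  assumes "odometer_seq p" "i \<le> j"
  shows "p i dvd p j"
  using assms(2)
proof (induction rule: dec_induct)
  case (step n)
  then show ?case using assms(1) by (metis dvd_trans odometer_seq_def)
qed simp

lemma odometer_seq_ge:
  assumes "odometer_seq p"
  shows "n \<le> p n"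
proof -
  have "strict_mono p" using assms by (simp add: odometer_seq_def strict_mono_Suc_iff)
  then show ?thesis by (rule strict_mono_imp_increasing)
qed

locale fence_tower = fence_system +
  fixes C :: real and P :: "nat \<Rightarrow> nat" and c :: "nat \<Rightarrow> 'a \<Rightarrow> nat" and z :: "nat \<Rightarrow> nat \<Rightarrow> 'a"
  assumes C: "0 < C"
    and level: "level (P n) (c n) (z n)"
    and models: "models (C / 2 ^ n) (c n) (z n)"
    and refines: "refines (C / 2 ^ Suc n) (P n) (c n) (z n) (P (Suc n)) (c (Suc n)) (z (Suc n))"

lemma (in fence_system) tower_exists:
  assumes p: "odometer_seq p"
  shows "\<exists>C P c z. fence_tower Y fL fU C P c z \<and> (\<forall>n. p n dvd P (Suc n) \<and> (\<exists>k. P n dvd p k))"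
proof -
  obtain y where y: "y \<in> Y" using Y_nonempty by blast
  obtain z0 where z0: "z0 \<in> Y" "fL z0 < fU z0"
    using fibre_approximation[of y "fL y" "fL y" Y 1 "{}"] y fence_bounds[OF y] by auto
  obtain B where B: "\<And>x. x \<in> Y \<Longrightarrow> dist z0 x \<le> B"
    using compact_imp_bounded[OF compact_Y] unfolding bounded_any_center[of _ z0] by blast
  \<comment> \<open>The one-cell partition must be an admissible stage 0: \<open>B\<close> bounds
    distances, 1 suffices for \<open>near\<close> because all values lie in [0,1], and
    \<open>1 / len z0\<close> gives \<open>len x \<le> 1 \<le> C * len z0\<close> for
    \<open>good\<close>.\<close>
  define C where "C = max (max 1 B) (1 / len z0)"
  have C: "1 \<le> C" "B \<le> C" "1 / len z0 \<le> C" by (auto simp: C_def)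
  define A where "A n s \<longleftrightarrow> (case s of (P, c, z) \<Rightarrow> level P c z \<and> models (C / 2 ^ n) c z \<and> (\<exists>k. P dvd p k))" for n s
  define Q where "Q n s s' \<longleftrightarrow> (case s of (P, c, z) \<Rightarrow> case s' of (P', c', z') \<Rightarrow>
      refines (C / 2 ^ Suc n) P c z P' c' z' \<and> p n dvd P')" for n s s'
  have "\<exists>f. \<forall>n. A n (f n) \<and> Q n (f n) (f (Suc n))"
  proof (rule dependent_nat_choice)
    have "level 1 (\<lambda>_. 0) (\<lambda>_. z0)" using z0 by (auto simp: level_def)
    moreover have "models C (\<lambda>_. 0) (\<lambda>_. z0)"
      unfolding models_def
    proof (intro ballI conjI)
      fix x assume x: "x \<in> Y"
      show "dist x z0 \<le> C" using B[OF x] C by (simp add: dist_commute)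
      show "near C x z0" using fence_bounds[OF x] fence_bounds[OF z0(1)] C by (simp add: near_def)
      have "1 \<le> C * len z0" using C(3) z0 by (simp add: divide_le_eq)
      then show "good C x z0" using fence_bounds[OF x] by (simp add: good_def)
    qed
    ultimately show "\<exists>s. A 0 s" by (intro exI[of _ "(1, \<lambda>_. 0, \<lambda>_. z0)"]) (auto simp: A_def)
  next
    fix s n assume "A n s"
    then obtain P c z k where s: "s = (P, c, z)" "level P c z" "P dvd p k" by (auto simp: A_def)
    have e: "0 < C / 2 ^ Suc n" using C by simp
    obtain R where R: "\<And>q. R + 2 \<le> q \<Longrightarrow> \<exists>c' z'. level (P * q) c' z' \<and> models (C / 2 ^ Suc n) c' z' \<and>
        refines (C / 2 ^ Suc n) P c z (P * q) c' z'"
      using refine_level[OF s(2) e] by blast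
    \<comment> \<open>The entry \<open>k\<close> keeps \<open>P\<close> a divisor of
      \<open>p k'\<close>, \<open>n\<close> yields divisibility by \<open>p n\<close>, and since
      \<open>k' \<le> p k'\<close> the last entry forces \<open>q \<ge> R + 2\<close>.\<close>
    define k' where "k' = max (max k n) (P * (R + 2))"
    have k': "k \<le> k'" "n \<le> k'" "P * (R + 2) \<le> k'" unfolding k'_def by linarith+
    have "P dvd p k'" using s(3) odometer_seq_dvd[OF p k'(1)] by (rule dvd_trans)
    then obtain q where q: "p k' = P * q" by blast
    have "P * (R + 2) \<le> P * q" using odometer_seq_ge[OF p, of k'] q k'(3) by linarith
    moreover have "0 < P" using s by (simp add: level_def)
    ultimately have "R + 2 \<le> q" by (metis mult_le_cancel1)
    then obtain c' z' where c': "level (P * q) c' z'" "models (C / 2 ^ Suc n) c' z'"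
        "refines (C / 2 ^ Suc n) P c z (P * q) c' z'"
      using R by blast
    have "p n dvd P * q" using odometer_seq_dvd[OF p k'(2)] q by simp
    moreover have "P * q dvd p k'" using q by simp
    ultimately have "A (Suc n) (P * q, c', z') \<and> Q n s (P * q, c', z')"
      using c' s by (auto simp: A_def Q_def)
    then show "\<exists>s'. A (Suc n) s' \<and> Q n s s'" by blast
  qed
  then obtain f where f: "\<And>n. A n (f n)" "\<And>n. Q n (f n) (f (Suc n))" by blast
  define P where "P n = fst (f n)" for n
  define c where "c n = fst (snd (f n))" for n
  define z where "z n = snd (snd (f n))" for n
  have fn: "f n = (P n, c n, z n)" for n by (simp add: P_def c_def z_def)
  have "fence_tower Y fL fU C P c z"
  proof
    show "0 < C" using C by simp
  qed (use f in \<open>simp_all add: fn A_def Q_def\<close>)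
  moreover have "p n dvd P (Suc n) \<and> (\<exists>k. P n dvd p k)" for n
    using f(1)[of n] f(2)[of n] by (simp add: fn A_def Q_def)
  ultimately show ?thesis by blast
qed

section \<open>Coherent labels\<close>

context fence_tower
begin

definition e :: "nat \<Rightarrow> real" where "e n = C / 2 ^ n"

definition zc :: "nat \<Rightarrow> 'a \<Rightarrow> 'a" where "zc n y = z n (c n y)"

lemma e_pos: "0 < e n" using C by (simp add: e_def)

lemma e_Suc: "e n = 2 * e (Suc n)" by (simp add: e_def)

lemma e_antimono: "m \<le> n \<Longrightarrow> e n \<le> e m"
  unfolding e_def using C by (intro divide_left_mono) (auto intro: power_increasing)

lemma e_tendsto: "e \<longlonglongrightarrow> 0"
proof -
  have "(\<lambda>n. C * (1/2)^n) \<longlonglongrightarrow> C * 0"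
    by (intro tendsto_mult tendsto_const LIMSEQ_realpow_zero) auto
  then show ?thesis by (simp add: power_divide e_def[abs_def])
qed

lemma P_pos: "0 < P n" and c_cont: "continuous_on Y (c n)" and c_less: "y \<in> Y \<Longrightarrow> c n y < P n"
  and z_in: "w < P n \<Longrightarrow> z n w \<in> Y" and c_z: "w < P n \<Longrightarrow> c n (z n w) = w"
  and len_z: "w < P n \<Longrightarrow> 0 < len (z n w)"
  using level[of n] by (auto simp: level_def)

lemma P_dvd_Suc: "P n dvd P (Suc n)" and c_Suc_mod: "y \<in> Y \<Longrightarrow> c (Suc n) y mod P n = c n y"
  using refines[of n] by (auto simp: refines_def)

lemma P_dvd: "m \<le> n \<Longrightarrow> P m dvd P n"
proof (induction rule: dec_induct)
  case (step n)
  then show ?case using P_dvd_Suc dvd_trans by blast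
qed simp

lemma mod_P: "m \<le> n \<Longrightarrow> v mod P n mod P m = v mod P m"
  by (simp add: P_dvd mod_mod_cancel)

lemma coherent_mod:
  assumes "\<And>n. v n < P n" "\<And>n. v (Suc n) mod P n = v n" "m \<le> n"
  shows "v n mod P m = v m"
  using assms(3)
proof (induction rule: dec_induct)
  case base
  then show ?case using assms(1) by simp
next
  case (step n)
  then show ?case using mod_P[of m n "v (Suc n)"] assms(2)[of n] by simp
qed

lemma c_mod: "y \<in> Y \<Longrightarrow> m \<le> n \<Longrightarrow> c n y mod P m = c m y"
  by (rule coherent_mod) (auto simp: c_less c_Suc_mod)

lemma zc_in: "y \<in> Y \<Longrightarrow> zc n y \<in> Y" and c_zc: "y \<in> Y \<Longrightarrow> c n (zc n y) = c n y"
  and len_zc: "y \<in> Y \<Longrightarrow> 0 < len (zc n y)"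
  using z_in[OF c_less] c_z[OF c_less] len_z[OF c_less] by (auto simp: zc_def)

lemma len_le_1: "y \<in> Y \<Longrightarrow> len y \<le> 1"
  using fence_bounds by fastforce

lemma zc_dist: "y \<in> Y \<Longrightarrow> dist y (zc n y) \<le> e n"
  and zc_near: "y \<in> Y \<Longrightarrow> near (e n) y (zc n y)"
  and zc_good: "y \<in> Y \<Longrightarrow> good (e n) y (zc n y)"
  using models[of n] by (auto simp: models_def zc_def e_def)

lemma zc_eq: "c n y = c n y' \<Longrightarrow> zc n y = zc n y'"
  by (simp add: zc_def)

lemma zc_zc: "y \<in> Y \<Longrightarrow> m \<le> n \<Longrightarrow> zc m (zc n y) = zc m y"
  by (metis c_mod c_zc zc_eq zc_in)

lemma zc_near_Suc: "y \<in> Y \<Longrightarrow> near (e (Suc n) * len (zc n y)) y (zc (Suc n) y)"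
  using refines[of n] by (auto simp: refines_def zc_def e_def)

lemma same_label_close:
  assumes "y \<in> Y" "y' \<in> Y" "c n y = c n y'"
  shows "dist y y' \<le> 2 * e n"
proof -
  have "zc n y = zc n y'" using assms(3) by (rule zc_eq)
  then show ?thesis
    using zc_dist[OF assms(1), of n] zc_dist[OF assms(2), of n] dist_triangle2[of y y' "zc n y"] by simp
qed

lemma label_unique:
  assumes "y \<in> Y" "y' \<in> Y" "\<And>n. c n y = c n y'"
  shows "y = y'"
proof -
  have "(\<lambda>n. 2 * e n) \<longlonglongrightarrow> 2 * 0" by (intro tendsto_mult e_tendsto tendsto_const)
  then have "dist y y' \<le> 2 * 0"
    by (rule LIMSEQ_le_const) (use same_label_close[OF assms] in auto)
  then show ?thesis by simp
qed

text \<open>A cluster point of the representatives with labels \<open>v n\<close> works: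
  \<open>c m\<close> is locally constant, so along the subsequence it eventually equals its value at
  the limit, and it also eventually equals \<open>v m\<close>.\<close>

lemma label_exists:
  assumes v: "\<And>n. v n < P n" "\<And>n. v (Suc n) mod P n = v n"
  shows "\<exists>y\<in>Y. \<forall>n. c n y = v n"
proof -
  have x: "\<forall>n. z n (v n) \<in> Y" using z_in v by blast
  obtain y r where y: "y \<in> Y" "strict_mono r" "((\<lambda>n. z n (v n)) \<circ> r) \<longlonglongrightarrow> y"
    using compact_imp_seq_compact[OF compact_Y] x by (rule seq_compactE)
  have "c m y = v m" for m
  proof -
    have "(\<lambda>n. c m (z (r n) (v (r n)))) \<longlonglongrightarrow> c m y"
      using continuous_on_tendsto_compose[OF c_cont y(3) y(1)] x by (simp add: o_def)
    then have "\<forall>\<^sub>F n in sequentially. c m (z (r n) (v (r n))) = c m y"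
      by (simp add: tendsto_discrete)
    moreover have "c m (z (r n) (v (r n))) = v m" if "m \<le> n" for n
    proof -
      have "m \<le> r n" using seq_suble[OF y(2), of n] that by simp
      then show ?thesis
        using c_mod[OF x[rule_format], of m "r n" "r n"] c_z[OF v(1)] coherent_mod[of v, OF v] by simp
    qed
    then have "\<forall>\<^sub>F n in sequentially. c m (z (r n) (v (r n))) = v m"
      by (rule eventually_sequentiallyI)
    ultimately have "\<forall>\<^sub>F n::nat in sequentially. c m y = v m" by eventually_elim simp
    then show ?thesis by simp
  qed
  then show ?thesis using y by blast
qed

section \<open>Convergence of the chosen fibres and comparison of cells with equal digits\<close>

lemma zc_tendsto:
  assumes "y \<in> Y"
  shows "(\<lambda>n. zc n y) \<longlonglongrightarrow> y"
proof -
  have "(\<lambda>n. dist (zc n y) y) \<longlonglongrightarrow> 0"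
    by (rule tendsto_sandwich[OF _ _ tendsto_const e_tendsto])
      (use zc_dist[OF assms] in \<open>auto simp: dist_commute\<close>)
  then show ?thesis by (subst tendsto_dist_iff)
qed

text \<open>Semicontinuity gives one inequality and \<open>near\<close> the other, although
  \<open>fL\<close> need not be continuous.\<close>

lemma fL_zc_tendsto:
  assumes y: "y \<in> Y"
  shows "(\<lambda>n. fL (zc n y)) \<longlonglongrightarrow> fL y"
proof (rule order_tendstoI)
  fix a assume "a < fL y"
  then show "\<forall>\<^sub>F n in sequentially. a < fL (zc n y)"
    by (rule eventually_fL_greater[OF zc_in[OF y] zc_tendsto[OF y] y])
next
  fix a assume "fL y < a"
  then have "\<forall>\<^sub>F n in sequentially. e n < a - fL y"
    using order_tendstoD(2)[OF e_tendsto, of "a - fL y"] by simp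
  then show "\<forall>\<^sub>F n in sequentially. fL (zc n y) < a"
  proof (rule eventually_mono)
    fix n assume "e n < a - fL y"
    then show "fL (zc n y) < a" using zc_near[OF y, of n] unfolding near_def by linarith
  qed
qed

lemma fU_zc_tendsto:
  assumes y: "y \<in> Y"
  shows "(\<lambda>n. fU (zc n y)) \<longlonglongrightarrow> fU y"
proof (rule order_tendstoI)
  fix a assume "fU y < a"
  then show "\<forall>\<^sub>F n in sequentially. fU (zc n y) < a"
    by (rule eventually_fU_less[OF zc_in[OF y] zc_tendsto[OF y] y])
next
  fix a assume "a < fU y"
  then have "\<forall>\<^sub>F n in sequentially. e n < fU y - a"
    using order_tendstoD(2)[OF e_tendsto, of "fU y - a"] by simp
  then show "\<forall>\<^sub>F n in sequentially. a < fU (zc n y)"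
  proof (rule eventually_mono)
    fix n assume "e n < fU y - a"
    then show "a < fU (zc n y)" using zc_near[OF y, of n] unfolding near_def by linarith
  qed
qed

lemma len_zc_tendsto: "y \<in> Y \<Longrightarrow> (\<lambda>n. len (zc n y)) \<longlonglongrightarrow> len y"
  by (intro tendsto_diff fL_zc_tendsto fU_zc_tendsto)

lemma digit_pattern:
  assumes y: "y \<in> Y" "y' \<in> Y" and dig: "c (Suc n) y div P n = c (Suc n) y' div P n"
  shows "\<bar>nrm (zc n y) (fL (zc (Suc n) y)) - nrm (zc n y') (fL (zc (Suc n) y'))\<bar> \<le> e (Suc n)"
    and "\<bar>nrm (zc n y) (fU (zc (Suc n) y)) - nrm (zc n y') (fU (zc (Suc n) y'))\<bar> \<le> e (Suc n)"
proof -
  define i where "i = c (Suc n) y div P n"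
  have split: "c (Suc n) x = c n x + P n * (c (Suc n) x div P n)" if "x \<in> Y" for x
    using c_Suc_mod[OF that, of n] mod_mult_div_eq[of "c (Suc n) x" "P n"] by simp
  have "c (Suc n) y < (P (Suc n) div P n) * P n" using c_less[OF y(1)] P_dvd_Suc[of n] by simp
  then have i: "i < P (Suc n) div P n" unfolding i_def by (rule less_mult_imp_div_less)
  have y1: "c (Suc n) y = c n y + P n * i" using split[OF y(1)] unfolding i_def .
  have y2: "c (Suc n) y' = c n y' + P n * i" using split[OF y(2)] unfolding i_def dig .
  have "\<forall>w<P n. \<forall>w'<P n. \<forall>i<P (Suc n) div P n.
       \<bar>nrm (z n w) (fL (z (Suc n) (w + P n * i))) - nrm (z n w') (fL (z (Suc n) (w' + P n * i)))\<bar> \<le> e (Suc n) \<and>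
       \<bar>nrm (z n w) (fU (z (Suc n) (w + P n * i))) - nrm (z n w') (fU (z (Suc n) (w' + P n * i)))\<bar> \<le> e (Suc n)"
    using refines[of n, folded e_def] unfolding refines_def by blast
  from this[rule_format, OF c_less[OF y(1)] c_less[OF y(2)] i]
  show "\<bar>nrm (zc n y) (fL (zc (Suc n) y)) - nrm (zc n y') (fL (zc (Suc n) y'))\<bar> \<le> e (Suc n)"
    and "\<bar>nrm (zc n y) (fU (zc (Suc n) y)) - nrm (zc n y') (fU (zc (Suc n) y'))\<bar> \<le> e (Suc n)"
    unfolding zc_def y1 y2 by blast+
qed

lemma zc_Suc_near: "y \<in> Y \<Longrightarrow> near (e n) (zc (Suc n) y) (zc n y)"
  and zc_Suc_good: "y \<in> Y \<Longrightarrow> good (e n) (zc (Suc n) y) (zc n y)"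
  using zc_near[OF zc_in, of y n "Suc n"] zc_good[OF zc_in, of y n "Suc n"] zc_zc[of y n "Suc n"] by simp_all

text \<open>The position \<open>s\<close> at stage n+1 is converted to stage n on both sides. By
  \<open>good_almost_affine\<close> each conversion is almost affine, and equal digits make the two
  affine maps almost equal.\<close>

lemma transfer_step:
  assumes y: "y \<in> Y" "y' \<in> Y" and dig: "c (Suc n) y div P n = c (Suc n) y' div P n"
    and t: "fL y \<le> t" "t \<le> fU y"
  shows "\<bar>aff (zc (Suc n) y') (nrm (zc (Suc n) y) t) - aff (zc n y') (nrm (zc n y) t)\<bar> \<le> 7 * e n"
proof -
  define x x1 x' x1' where "x = zc n y" and "x1 = zc (Suc n) y" and "x' = zc n y'" and "x1' = zc (Suc n) y'"
  note defs = x_def x1_def x'_def x1'_def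
  have len: "0 < len x" "0 < len x1" "0 < len x'" "0 < len x1'" using len_zc y by (auto simp: defs)
  define s where "s = nrm x1 t"
  have s: "0 \<le> s" "s \<le> 1" using nrm_range by (auto simp: s_def)
  define u u' where "u = (1 - s) * nrm x (fL x1) + s * nrm x (fU x1)"
    and "u' = (1 - s) * nrm x' (fL x1') + s * nrm x' (fU x1')"
  have "\<bar>aff x1 s - t\<bar> \<le> e (Suc n) * len x"
    unfolding s_def using zc_near_Suc[OF y(1), of n] t len e_pos[of "Suc n"]
    by (intro clamp_close mult_nonneg_nonneg) (auto simp: near_def defs)
  then have "\<bar>aff x1 s - t\<bar> / len x \<le> e (Suc n)" using len by (simp add: pos_divide_le_eq)
  then have 1: "\<bar>nrm x (aff x1 s) - nrm x t\<bar> \<le> e (Suc n)"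
    using nrm_lipschitz[OF len(1), of "aff x1 s" t] by linarith
  have 2: "\<bar>nrm x (aff x1 s) - u\<bar> \<le> 2 * e n"
    unfolding u_def using len e_pos[of n] s zc_Suc_good[OF y(1), of n]
    by (intro good_almost_affine) (auto simp: defs)
  have 3: "\<bar>nrm x' (aff x1' s) - u'\<bar> \<le> 2 * e n"
    unfolding u'_def using len e_pos[of n] s zc_Suc_good[OF y(2), of n]
    by (intro good_almost_affine) (auto simp: defs)
  have 4: "\<bar>u - u'\<bar> \<le> e (Suc n)"
    unfolding u_def u'_def using digit_pattern[OF y dig] s by (intro convex_combination_diff) (auto simp: defs)
  \<comment> \<open>The four errors total \<open>5 * e n\<close>, since
    \<open>e n = 2 * e (Suc n)\<close>.\<close>
  have 5: "\<bar>nrm x' (aff x1' s) - nrm x t\<bar> \<le> 6 * e n"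
    using 1 2 3 4 e_Suc[of n] e_pos[of "Suc n"] by linarith
  have 6: "\<bar>aff x' (nrm x' (aff x1' s)) - aff x1' s\<bar> \<le> e n"
    using aff_range[OF len(4) s] zc_Suc_near[OF y(2), of n] len e_pos[of n]
    by (intro clamp_close) (auto simp: near_def defs)
  have "aff x' (nrm x' (aff x1' s)) - aff x' (nrm x t) = (nrm x' (aff x1' s) - nrm x t) * len x'"
    by (simp add: aff_def algebra_simps)
  also have "\<bar>\<dots>\<bar> \<le> (6 * e n) * 1"
    unfolding abs_mult using 5 len(3) len_le_1[OF zc_in[OF y(2), of n]] e_pos[of n]
    by (intro mult_mono) (auto simp: defs)
  finally have "\<bar>aff x' (nrm x' (aff x1' s)) - aff x' (nrm x t)\<bar> \<le> 6 * e n" by simp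
  then have "\<bar>aff x1' s - aff x' (nrm x t)\<bar> \<le> 7 * e n" using 6 by linarith
  then show ?thesis by (simp add: s_def defs)
qed

text \<open>Additive errors are useless when lengths may tend to 0, so the ratio \<open>r n\<close>
  of the chosen lengths is followed. A step costs at most the factor \<open>1 - D * e n\<close>, and
  summability of \<open>e\<close> keeps the product of these factors away from 0.\<close>

lemma len_positive_transfer:
  assumes y: "y \<in> Y" "y' \<in> Y" and dig: "\<And>n. k \<le> n \<Longrightarrow> c (Suc n) y div P n = c (Suc n) y' div P n"
    and l: "0 < len y"
  shows "0 < len y'"
proof -
  define a b where "a n = len (zc n y)" and "b n = len (zc n y')" for n
  have pos: "0 < a n" "0 < b n" and a1: "a n \<le> 1" for n
    using len_zc y len_le_1[OF zc_in] by (auto simp: a_def b_def)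
  have lim: "a \<longlonglongrightarrow> len y" "b \<longlonglongrightarrow> len y'" unfolding a_def b_def using len_zc_tendsto y by auto
  \<comment> \<open>With \<open>a (Suc n) > len y / 2\<close> the constant 6 gives
    \<open>3 \<le> D * a (Suc n)\<close>, which absorbs an additive error \<open>3 * e n\<close>.
    The later threshold \<open>1 / (4 * D)\<close> keeps the product of the factors at least
    1/2.\<close>
  define D where "D = 6 / len y"
  have D: "0 < D" using l by (simp add: D_def)
  have "\<forall>\<^sub>F n in sequentially. len y / 2 < a n" using lim(1) l by (intro order_tendstoD) auto
  moreover have "\<forall>\<^sub>F n in sequentially. e n < 1 / (4 * D)"
    using e_tendsto D by (intro order_tendstoD) auto
  ultimately have "\<forall>\<^sub>F n in sequentially. len y / 2 < a n \<and> e n < 1 / (4 * D) \<and> k \<le> n"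
    using eventually_ge_at_top[of k] by eventually_elim auto
  then obtain N where N: "\<And>n. N \<le> n \<Longrightarrow> len y / 2 < a n \<and> e n < 1 / (4 * D) \<and> k \<le> n"
    unfolding eventually_sequentially by blast
  have De: "D * e n < 1/4" if "N \<le> n" for n
    using N[OF that] D by (simp add: field_simps)
  define r where "r n = b n / a n" for n
  have r_pos: "0 < r n" for n using pos by (simp add: r_def)
  have step: "r n * (1 - D * e n) \<le> r (Suc n)" if n: "N \<le> n" for n
  proof -
    define x x1 x' x1' where "x = zc n y" and "x1 = zc (Suc n) y" and "x' = zc n y'" and "x1' = zc (Suc n) y'"
    note defs = x_def x1_def x'_def x1'_def
    have len: "0 < len x" "0 < len x1" "0 < len x'" "0 < len x1'" using len_zc y by (auto simp: defs)
    have "c (Suc n) y div P n = c (Suc n) y' div P n" using dig N[OF n] by blast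
    note pat = digit_pattern[OF y this, folded defs]
    have K: "fL x - e n \<le> fL x1" "fU x1 \<le> fU x + e n"
      using zc_Suc_near[OF y(1), of n] by (auto simp: near_def defs)
    \<comment> \<open>Clamping to the fibre of \<open>x\<close> costs at most \<open>e n\<close> at
      each end. Clamping to that of \<open>x'\<close> can only shorten, the harmless direction for a
      lower bound on \<open>b (Suc n) / b n\<close>.\<close>
    have "\<bar>aff x (nrm x (fU x1)) - fU x1\<bar> \<le> e n" "\<bar>aff x (nrm x (fL x1)) - fL x1\<bar> \<le> e n"
      using K len e_pos[of n] by (auto intro!: clamp_close)
    then have "len x1 - 2 * e n \<le> aff x (nrm x (fU x1)) - aff x (nrm x (fL x1))" by linarith
    also have "\<dots> = (nrm x (fU x1) - nrm x (fL x1)) * len x" by (simp add: aff_def algebra_simps)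
    also have "\<dots> \<le> (len x1' / len x' + e n) * len x"
    proof (rule mult_right_mono)
      have "\<bar>nrm x' (fU x1') - nrm x' (fL x1')\<bar> \<le> len x1' / len x'"
        using nrm_lipschitz[OF len(3), of "fU x1'" "fL x1'"] len by simp
      then show "nrm x (fU x1) - nrm x (fL x1) \<le> len x1' / len x' + e n"
        using pat e_Suc[of n] by linarith
    qed (use len in simp)
    also have "\<dots> = b (Suc n) / b n * a n + e n * a n" by (simp add: a_def b_def defs algebra_simps)
    also have "\<dots> \<le> b (Suc n) / b n * a n + e n" using a1[of n] e_pos[of n] by simp
    finally have "a (Suc n) - 3 * e n \<le> b (Suc n) / b n * a n" by (simp add: a_def defs)
    moreover have "3 * e n \<le> D * e n * a (Suc n)"
    proof -
      have "len y / 2 < a (Suc n)" using N[of "Suc n"] n by simp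
      then have "3 \<le> D * a (Suc n)" using l by (simp add: D_def field_simps)
      then have "3 * e n \<le> (D * a (Suc n)) * e n" using e_pos[of n] by (intro mult_right_mono) auto
      then show ?thesis by (simp add: mult_ac)
    qed
    ultimately have "a (Suc n) * (1 - D * e n) \<le> b (Suc n) / b n * a n" by (simp add: algebra_simps)
    then show ?thesis using pos[of n] pos[of "Suc n"] by (simp add: r_def field_simps)
  qed
  \<comment> \<open>\<open>2 * (e N - e n)\<close> is the telescoped sum of \<open>e k\<close> over
    \<open>N \<le> k < n\<close>, and a product of factors \<open>1 - D * e k\<close> is at least 1
    minus the sum of the \<open>D * e k\<close>.\<close>
  have bound: "r N * (1 - 2 * D * (e N - e n)) \<le> r n" if "N \<le> n" for n
    using that
  proof (induction rule: dec_induct)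
    case (step n)
    define p q where "p = 2 * D * (e N - e n)" and "q = D * e n"
    have "e n \<le> e N" using step(1) by (rule e_antimono)
    then have "0 \<le> p" using D by (simp add: p_def)
    have q: "0 \<le> q" "q \<le> 1" using D e_pos[of n] De[of n] step(1) by (auto simp: q_def)
    have "2 * D * (e N - e (Suc n)) = p + q"
      using e_Suc[of n] by (simp add: p_def q_def algebra_simps)
    then have "r N * (1 - 2 * D * (e N - e (Suc n))) = r N * (1 - p - q)" by simp
    also have "\<dots> \<le> r N * ((1 - p) * (1 - q))"
      using r_pos[of N] \<open>0 \<le> p\<close> q by (intro mult_left_mono) (auto simp: algebra_simps)
    also have "\<dots> = (r N * (1 - p)) * (1 - q)" by simp
    also have "\<dots> \<le> r n * (1 - q)" using step.IH q by (intro mult_right_mono) (auto simp: p_def)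
    also have "\<dots> \<le> r (Suc n)" unfolding q_def using \<open>N \<le> n\<close> by (rule \<open>\<And>n. N \<le> n \<Longrightarrow> r n * (1 - D * e n) \<le> r (Suc n)\<close>)
    finally show ?case .
  qed simp
  have "r N / 2 * a n \<le> b n" if "N \<le> n" for n
  proof -
    have "2 * D * (e N - e n) \<le> 1/2"
    proof -
      have "D * e N < 1/4" "0 < D * e n" using De[of N] D e_pos[of n] by auto
      moreover have "2 * D * (e N - e n) = 2 * (D * e N) - 2 * (D * e n)" by (simp add: algebra_simps)
      ultimately show ?thesis by linarith
    qed
    then have "r N * (1/2) \<le> r N * (1 - 2 * D * (e N - e n))"
      using r_pos[of N] by (intro mult_left_mono) auto
    then have "r N / 2 \<le> b n / a n" using bound[OF that] unfolding r_def[of n] by linarith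
    then show ?thesis using pos[of n] by (simp add: pos_le_divide_eq)
  qed
  then have "r N / 2 * len y \<le> len y'"
    by (intro LIMSEQ_le[OF tendsto_mult[OF tendsto_const lim(1)] lim(2)] exI[of _ N] allI impI)
  moreover have "0 < r N / 2 * len y" using r_pos[of N] l by simp
  ultimately show ?thesis by linarith
qed

section \<open>The lifted odometer\<close>

text \<open>The choice is forced, because labels determine a point.\<close>

definition S :: "'a \<Rightarrow> 'a" where
  "S y = (SOME x. x \<in> Y \<and> (\<forall>n. c n x = (c n y + 1) mod P n))"

lemma S_in: "y \<in> Y \<Longrightarrow> S y \<in> Y" and c_S: "y \<in> Y \<Longrightarrow> c n (S y) = (c n y + 1) mod P n"
proof -
  assume y: "y \<in> Y"
  have "\<exists>x\<in>Y. \<forall>n. c n x = (c n y + 1) mod P n"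
  proof (rule label_exists)
    fix n
    show "(c n y + 1) mod P n < P n" using P_pos by simp
    have "(c (Suc n) y + 1) mod P (Suc n) mod P n = (c (Suc n) y + 1) mod P n"
      by (rule mod_P) simp
    also have "\<dots> = (c n y + 1) mod P n" using c_Suc_mod[OF y, of n] by (metis mod_add_left_eq)
    finally show "(c (Suc n) y + 1) mod P (Suc n) mod P n = (c n y + 1) mod P n" .
  qed
  then have "\<exists>x. x \<in> Y \<and> (\<forall>n. c n x = (c n y + 1) mod P n)" by blast
  then have "S y \<in> Y \<and> (\<forall>n. c n (S y) = (c n y + 1) mod P n)"
    unfolding S_def by (rule someI_ex)
  then show "S y \<in> Y" "c n (S y) = (c n y + 1) mod P n" by auto
qed

lemma S_surj:
  assumes x: "x \<in> Y"
  shows "\<exists>y\<in>Y. S y = x"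
proof -
  \<comment> \<open>Adding \<open>P n - 1\<close> is subtraction of 1 modulo
    \<open>P n\<close>.\<close>
  have "\<exists>y\<in>Y. \<forall>n. c n y = (c n x + (P n - 1)) mod P n"
  proof (rule label_exists)
    fix n
    show "(c n x + (P n - 1)) mod P n < P n" using P_pos by simp
    have "(c (Suc n) x + (P (Suc n) - 1)) mod P (Suc n) mod P n = (c (Suc n) x + (P (Suc n) - 1)) mod P n"
      by (rule mod_P) simp
    also have "\<dots> = (c n x + (P n - 1)) mod P n"
      using c_Suc_mod[OF x, of n] pred_mod_dvd[OF P_dvd_Suc[of n] P_pos[of "Suc n"]] by (metis mod_add_eq)
    finally show "(c (Suc n) x + (P (Suc n) - 1)) mod P (Suc n) mod P n = (c n x + (P n - 1)) mod P n" .
  qed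
  then obtain y where y: "y \<in> Y" "\<And>n. c n y = (c n x + (P n - 1)) mod P n" by blast
  have "c n (S y) = c n x" for n
  proof -
    have "c n (S y) = (c n x + (P n - 1) + 1) mod P n"
      using c_S[OF y(1), of n] y(2)[of n] by (metis mod_add_left_eq)
    also have "\<dots> = c n x" using P_pos[of n] c_less[OF x, of n] by simp
    finally show ?thesis .
  qed
  then show ?thesis using label_unique[OF S_in[OF y(1)] x] y(1) by blast
qed

lemma S_inj:
  assumes y: "y \<in> Y" "y' \<in> Y" and eq: "S y = S y'"
  shows "y = y'"
proof (rule label_unique[OF y])
  fix n
  have "Suc (c n y) mod P n = Suc (c n y') mod P n" using c_S[OF y(1), of n] c_S[OF y(2), of n] eq by simp
  then show "c n y = c n y'" using c_less[OF y(1), of n] c_less[OF y(2), of n]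
    by (auto simp: mod_Suc split: if_splits)
qed

text \<open>Last labels reduce to last labels; hence a carry excluded at one stage is excluded at
  all later ones.\<close>

lemma not_last_mono:
  assumes "y \<in> Y" "c m y \<noteq> P m - 1" "m \<le> n"
  shows "c n y \<noteq> P n - 1"
  using assms c_mod[OF assms(1,3)] pred_mod_dvd[OF P_dvd[OF assms(3)] P_pos[of n]] by metis

lemma S_digit:
  assumes y: "y \<in> Y" and last: "c n y \<noteq> P n - 1"
  shows "c (Suc n) y div P n = c (Suc n) (S y) div P n"
proof -
  have "c (Suc n) y \<noteq> P (Suc n) - 1" by (rule not_last_mono[OF y last]) simp
  then have "c (Suc n) (S y) = Suc (c (Suc n) y)"
    using c_S[OF y, of "Suc n"] c_less[OF y, of "Suc n"] by simp
  moreover have "Suc (c (Suc n) y) mod P n \<noteq> 0"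
    using c_Suc_mod[OF y, of n] last by (auto simp: mod_Suc)
  ultimately show ?thesis by (simp add: div_Suc)
qed

text \<open>Smallness comes from a refinement, so it starts at stage 1; this is the origin of the
  assumption \<open>1 \<le> n\<close> in the error bounds for the lift.\<close>

lemma small_first: "c (Suc n) y = 0 \<Longrightarrow> len (zc (Suc n) y) \<le> e (Suc n)"
  and small_last: "c (Suc n) y = P (Suc n) - 1 \<Longrightarrow> len (zc (Suc n) y) \<le> e (Suc n)"
proof -
  have *: "len (z (Suc n) v) \<le> e (Suc n)" if "v < P (Suc n)" "v < P n \<or> P (Suc n) - P n \<le> v" for v
    using refines[of n, folded e_def] that unfolding refines_def by blast
  show "c (Suc n) y = 0 \<Longrightarrow> len (zc (Suc n) y) \<le> e (Suc n)"
    using *[of 0] P_pos by (simp add: zc_def)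
  have "P (Suc n) - P n \<le> P (Suc n) - 1" using P_pos[of n] by simp
  then show "c (Suc n) y = P (Suc n) - 1 \<Longrightarrow> len (zc (Suc n) y) \<le> e (Suc n)"
    using *[of "P (Suc n) - 1"] P_pos[of "Suc n"] by (simp add: zc_def)
qed

lemma S_last: "y \<in> Y \<Longrightarrow> c n y = P n - 1 \<Longrightarrow> c n (S y) = 0"
  using c_S[of y n] P_pos[of n] by simp

lemma len_zero_limit:
  assumes y: "y \<in> Y" and "\<And>n. len (zc (Suc n) y) \<le> e (Suc n)"
  shows "len y = 0"
proof -
  have "len y \<le> 0"
    using assms(2) by (intro LIMSEQ_le[OF LIMSEQ_Suc[OF len_zc_tendsto[OF y]] LIMSEQ_Suc[OF e_tendsto]]) blast
  then show ?thesis using fence_bounds[OF y] by auto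
qed

text \<open>If every label of \<open>y\<close> is last, both fibres are limits of short ones, hence
  degenerate. Otherwise no carry occurs from some stage on, the digits of \<open>y\<close> and
  \<open>S y\<close> agree there, and positivity transfers both ways.\<close>

lemma len_S:
  assumes y: "y \<in> Y"
  shows "0 < len y \<longleftrightarrow> 0 < len (S y)"
proof (cases "\<forall>n. c n y = P n - 1")
  case True
  have "len y = 0" by (rule len_zero_limit[OF y small_last]) (use True in blast)
  moreover have "len (S y) = 0"
    by (rule len_zero_limit[OF S_in[OF y] small_first]) (use True S_last[OF y] in blast)
  ultimately show ?thesis by simp
next
  case False
  then obtain k where k: "c k y \<noteq> P k - 1" by blast
  have dig: "c (Suc n) y div P n = c (Suc n) (S y) div P n" if "k \<le> n" for n
    by (rule S_digit[OF y not_last_mono[OF y k that]])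
  show ?thesis
    using len_positive_transfer[OF y S_in[OF y] dig] len_positive_transfer[OF S_in[OF y] y dig[symmetric]] by blast
qed

text \<open>Depends on \<open>y\<close> only through its label at stage \<open>n\<close>, hence is
  continuous even where \<open>fL\<close> or \<open>fU\<close> jumps.\<close>

definition Tf :: "nat \<Rightarrow> 'a \<Rightarrow> real \<Rightarrow> real" where
  "Tf n y t = aff (zc n (S y)) (nrm (zc n y) t)"

text \<open>If the fibre of \<open>y\<close> is degenerate, then \<open>t = fL y\<close> and the value 0 of the quotient is harmless.\<close>
definition Ts :: "'a \<Rightarrow> real \<Rightarrow> real" where
  "Ts y t = fL (S y) + (t - fL y) * (len (S y) / len y)"

lemma Tf_range:
  assumes "y \<in> Y"
  shows "fL (zc n (S y)) \<le> Tf n y t" "Tf n y t \<le> fU (zc n (S y))"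
  unfolding Tf_def using aff_range[OF len_zc[OF S_in[OF assms]] nrm_range] by auto

text \<open>The bound has to be uniform in \<open>y\<close>. At a last label the digits of
  \<open>y\<close> and \<open>S y\<close> may differ, but all later values lie within
  \<open>e n\<close> of an interval of length at most \<open>e n\<close>. Elsewhere the steps
  \<open>7 * e k\<close> add up to \<open>14 * (e n - e m)\<close>.\<close>

lemma Tf_cauchy:
  assumes y: "y \<in> Y" and t: "fL y \<le> t" "t \<le> fU y" and n: "1 \<le> n" "n \<le> m"
  shows "\<bar>Tf m y t - Tf n y t\<bar> \<le> 14 * e n"
proof (cases "c n y = P n - 1")
  case True
  obtain n' where n': "n = Suc n'" using n by (cases n) auto
  have "len (zc n (S y)) \<le> e n" using small_first[of n' "S y"] S_last[OF y True] unfolding n' by simp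
  moreover have "near (e n) (zc m (S y)) (zc n (S y))"
    using zc_near[OF zc_in[OF S_in[OF y]], of n m] zc_zc[OF S_in[OF y] n(2)] by simp
  ultimately show ?thesis
    using Tf_range[OF y, of n t] Tf_range[OF y, of m t] e_pos[of n] unfolding near_def by linarith
next
  case False
  have "\<bar>Tf m y t - Tf n y t\<bar> \<le> 14 * (e n - e m)"
    using n(2)
  proof (induction rule: dec_induct)
    case (step k)
    have "\<bar>Tf (Suc k) y t - Tf k y t\<bar> \<le> 7 * e k"
      unfolding Tf_def
      by (rule transfer_step[OF y S_in[OF y] S_digit[OF y not_last_mono[OF y False step(1)]] t])
    moreover have "e k = 2 * e (Suc k)" by (rule e_Suc)
    ultimately show ?case using step.IH by (simp add: right_diff_distrib)
  qed simp
  then show ?thesis using e_pos[of m] by simp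
qed

text \<open>Over a nondegenerate fibre the clamp disappears in the limit. Over a degenerate one the
  fibre of \<open>S y\<close> is degenerate too, and the values are squeezed between its
  approximating endpoints.\<close>

lemma Tf_tendsto:
  assumes y: "y \<in> Y" and t: "fL y \<le> t" "t \<le> fU y"
  shows "(\<lambda>n. Tf n y t) \<longlonglongrightarrow> Ts y t"
proof (cases "0 < len y")
  case True
  have "(\<lambda>n. Tf n y t) \<longlonglongrightarrow> fL (S y) + max 0 (min 1 ((t - fL y) / len y)) * len (S y)"
    unfolding Tf_def aff_def nrm_def using True
    by (intro tendsto_intros fL_zc_tendsto len_zc_tendsto S_in y tendsto_max tendsto_min) auto
  moreover have "max 0 (min 1 ((t - fL y) / len y)) = (t - fL y) / len y" using t True by simp
  ultimately show ?thesis by (simp add: Ts_def)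
next
  case False
  then have "len (S y) = 0" "t = fL y"
    using len_S[OF y] fence_bounds[OF S_in[OF y]] fence_bounds[OF y] t by auto
  have "(\<lambda>n. Tf n y t) \<longlonglongrightarrow> fL (S y)"
  proof (rule tendsto_sandwich[OF _ _ fL_zc_tendsto[OF S_in[OF y]]])
    show "(\<lambda>n. fU (zc n (S y))) \<longlonglongrightarrow> fL (S y)"
      using fU_zc_tendsto[OF S_in[OF y]] \<open>len (S y) = 0\<close> by simp
  qed (use Tf_range[OF y] in auto)
  then show ?thesis using \<open>t = fL y\<close> by (simp add: Ts_def)
qed

lemma Tf_error:
  assumes "y \<in> Y" "fL y \<le> t" "t \<le> fU y" "1 \<le> n"
  shows "\<bar>Ts y t - Tf n y t\<bar> \<le> 14 * e n"
proof (rule LIMSEQ_le_const2)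
  show "(\<lambda>m. \<bar>Tf m y t - Tf n y t\<bar>) \<longlonglongrightarrow> \<bar>Ts y t - Tf n y t\<bar>"
    using Tf_tendsto[OF assms(1-3)] by (intro tendsto_intros)
  show "\<exists>N. \<forall>m\<ge>N. \<bar>Tf m y t - Tf n y t\<bar> \<le> 14 * e n" using Tf_cauchy[OF assms] by blast
qed

section \<open>The lift as a continuous bijection of the fence\<close>

abbreviation F :: "('a \<times> real) set" where "F \<equiv> fence Y fL fU"

lemma continuous_on_label:
  fixes h :: "nat \<Rightarrow> 'b::topological_space"
  shows "continuous_on F (\<lambda>q. h (c n (fst q)))"
proof -
  have "continuous_on F (\<lambda>q. c n (fst q))"
    by (rule continuous_on_compose2[OF c_cont continuous_on_fst[OF continuous_on_id]]) (auto simp: fence_def)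
  then show ?thesis
    by (rule continuous_on_compose2[of UNIV h, rotated]) auto
qed

lemma continuous_on_uniform_error:
  fixes f :: "nat \<Rightarrow> 'b::topological_space \<Rightarrow> 'c::metric_space"
  assumes "\<And>n. continuous_on A (f n)" "\<And>n x. 1 \<le> n \<Longrightarrow> x \<in> A \<Longrightarrow> dist (f n x) (g x) \<le> K * e n"
  shows "continuous_on A g"
proof (rule uniform_limit_theorem[where f = f and F = sequentially])
  show "uniform_limit A f g sequentially"
  proof (rule uniform_limitI)
    fix d :: real assume "0 < d"
    have "(\<lambda>n. K * e n) \<longlonglongrightarrow> K * 0" by (intro tendsto_mult e_tendsto tendsto_const)
    then have "\<forall>\<^sub>F n in sequentially. K * e n < d" using \<open>0 < d\<close> by (intro order_tendstoD) auto
    then show "\<forall>\<^sub>F n in sequentially. \<forall>x\<in>A. dist (f n x) (g x) < d"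
      using eventually_ge_at_top[of 1] by eventually_elim (use assms(2) in \<open>meson le_less_trans\<close>)
  qed
qed (use assms(1) in auto)

definition T :: "'a \<times> real \<Rightarrow> 'a \<times> real" where
  "T q = (S (fst q), Ts (fst q) (snd q))"

text \<open>Both coordinates are uniform limits of maps seeing the base point only through its
  label; the formula for \<open>Ts\<close>, built from semicontinuous functions, does not show
  continuity.\<close>

lemma continuous_T: "continuous_on F T"
proof -
  have "continuous_on F (\<lambda>q. S (fst q))"
  proof (rule continuous_on_uniform_error)
    show "continuous_on F (\<lambda>q. z n ((c n (fst q) + 1) mod P n))" for n
      by (rule continuous_on_label)
    show "dist (z n ((c n (fst q) + 1) mod P n)) (S (fst q)) \<le> 1 * e n" if "1 \<le> n" "q \<in> F" for n q
    proof -
      have "fst q \<in> Y" using that by (auto simp: fence_def)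
      then show ?thesis using zc_dist[OF S_in, of "fst q" n] c_S[of "fst q" n] by (simp add: zc_def dist_commute)
    qed
  qed
  moreover have "continuous_on F (\<lambda>q. Ts (fst q) (snd q))"
  proof (rule continuous_on_uniform_error)
    fix n
    define next_z where "next_z w = z n ((w + 1) mod P n)" for w
    have "continuous_on F (\<lambda>q. fL (next_z (c n (fst q))) +
       max 0 (min 1 ((snd q - fL (z n (c n (fst q)))) / len (z n (c n (fst q))))) * len (next_z (c n (fst q))))"
    proof (intro continuous_on_add continuous_on_mult continuous_on_divide continuous_on_diff continuous_on_max
        continuous_on_min continuous_on_const continuous_on_snd continuous_on_id ballI
        continuous_on_label[of "\<lambda>w. fL (next_z w)"] continuous_on_label[of "\<lambda>w. fU (next_z w)"]
        continuous_on_label[of "\<lambda>w. fL (z n w)"] continuous_on_label[of "\<lambda>w. fU (z n w)"])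
      fix q assume "q \<in> F"
      then show "len (z n (c n (fst q))) \<noteq> 0" using len_z[OF c_less, of "fst q" n] by (auto simp: fence_def)
    qed
    then show "continuous_on F (\<lambda>q. Tf n (fst q) (snd q))"
      by (rule continuous_on_eq) (auto simp: Tf_def aff_def nrm_def zc_def next_z_def c_S fence_def)
  next
    show "dist (Tf n (fst q) (snd q)) (Ts (fst q) (snd q)) \<le> 14 * e n" if "1 \<le> n" "q \<in> F" for n q
      using Tf_error[of "fst q" "snd q" n] that by (auto simp: fence_def dist_real_def abs_minus_commute)
  qed
  ultimately show ?thesis unfolding T_def[abs_def] by (rule continuous_on_Pair)
qed

lemma T_in: "q \<in> F \<Longrightarrow> T q \<in> F"
proof -
  assume "q \<in> F"
  then have y: "fst q \<in> Y" "fL (fst q) \<le> snd q" "snd q \<le> fU (fst q)" by (auto simp: fence_def)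
  define s where "s = (snd q - fL (fst q)) / len (fst q)"
  have s: "0 \<le> s" "s \<le> 1" using y by (auto simp: s_def divide_le_eq)
  have "0 \<le> len (S (fst q))" using fence_bounds[OF S_in[OF y(1)]] by simp
  then have "0 \<le> s * len (S (fst q))" "s * len (S (fst q)) \<le> 1 * len (S (fst q))"
    using s mult_right_mono[of s 1 "len (S (fst q))"] by auto
  moreover have "Ts (fst q) (snd q) = fL (S (fst q)) + s * len (S (fst q))" by (simp add: Ts_def s_def)
  ultimately show "T q \<in> F" using S_in[OF y(1)] by (auto simp: T_def fence_def)
qed

lemma T_surj: "T ` F = F"
proof
  show "T ` F \<subseteq> F" using T_in by blast
  show "F \<subseteq> T ` F"
  proof
    fix q assume "q \<in> F"
    then obtain x s where q: "q = (x, s)" "x \<in> Y" "fL x \<le> s" "s \<le> fU x" by (auto simp: fence_def)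
    obtain y where y: "y \<in> Y" "S y = x" using S_surj[OF q(2)] by blast
    \<comment> \<open>Over a degenerate fibre the quotient is 0, so its bounds persist; by
      \<open>len_S\<close> the fibres over \<open>x\<close> and \<open>y\<close> are degenerate
      simultaneously.\<close>
    define r where "r = (s - fL x) / len x"
    have r: "0 \<le> r" "r \<le> 1" using q by (auto simp: r_def divide_le_eq)
    define t where "t = fL y + r * len y"
    have "0 \<le> len y" using fence_bounds[OF y(1)] by simp
    then have "0 \<le> r * len y" "r * len y \<le> 1 * len y"
      using r mult_right_mono[of r 1 "len y"] by auto
    then have "(y, t) \<in> F" using y by (auto simp: t_def fence_def)
    moreover have "Ts y t = s"
    proof (cases "0 < len y")
      case True
      then show ?thesis using len_S[OF y(1)] y(2) by (simp add: Ts_def t_def r_def)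
    next
      case False
      then have "len x = 0" using len_S[OF y(1)] y(2) fence_bounds[OF q(2)] by auto
      then show ?thesis using q y(2) by (simp add: Ts_def)
    qed
    ultimately show "q \<in> T ` F" using q(1) y(2) by (force simp: T_def image_iff)
  qed
qed

lemma T_inj: "inj_on T F"
proof (rule inj_onI)
  fix q q' assume q: "q \<in> F" "q' \<in> F" and eq: "T q = T q'"
  obtain y t y' t' where qq: "q = (y, t)" "q' = (y', t')" by fastforce
  have y: "y \<in> Y" "y' \<in> Y" "fL y \<le> t" "t \<le> fU y" "fL y' \<le> t'" "t' \<le> fU y'" using q qq by (auto simp: fence_def)
  have "y = y'" using S_inj[OF y(1,2)] eq qq by (simp add: T_def)
  moreover have "t = t'"
  proof (cases "0 < len y")
    case True
    then have "0 < len (S y) / len y" using len_S[OF y(1)] by simp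
    moreover have "(t - fL y) * (len (S y) / len y) = (t' - fL y) * (len (S y) / len y)"
      using eq qq \<open>y = y'\<close> by (simp add: T_def Ts_def)
    ultimately have "t - fL y = t' - fL y" by (metis less_irrefl mult_right_cancel)
    then show ?thesis by simp
  next
    case False
    then show ?thesis using y \<open>y = y'\<close> by auto
  qed
  ultimately show "q = q'" using qq by simp
qed

section \<open>Density of forward orbits and the odometer factor\<close>

lemma T_iterate:
  assumes "q \<in> F"
  shows "(T ^^ k) q \<in> F \<and> c n (fst ((T ^^ k) q)) = (c n (fst q) + k) mod P n"
proof (induction k)
  case 0
  then show ?case using assms c_less by (auto simp: fence_def)
next
  case (Suc k)
  then have "fst ((T ^^ k) q) \<in> Y" by (auto simp: fence_def)
  then have "c n (fst ((T ^^ Suc k) q)) = (c n (fst ((T ^^ k) q)) + 1) mod P n"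
    using c_S by (simp add: T_def)
  then show ?case using Suc T_in by (simp add: mod_Suc_eq)
qed

text \<open>Orbits are controlled only through labels, so the part of the fence over a whole cell
  must lie near \<open>q0\<close>. Approximating the point interval at \<open>t0\<close> by the
  fibre of some \<open>y1\<close> provides such a cell, since \<open>near\<close> confines its
  fibres to a neighbourhood of one already close to \<open>t0\<close>.\<close>

lemma T_dense:
  assumes q: "q \<in> F"
  shows "F \<subseteq> closure {(T ^^ k) q | k. True}"
proof
  fix q0 assume "q0 \<in> F"
  then obtain y0 t0 where q0: "q0 = (y0, t0)" "y0 \<in> Y" "fL y0 \<le> t0" "t0 \<le> fU y0" by (auto simp: fence_def)
  show "q0 \<in> closure {(T ^^ k) q | k. True}"
    unfolding closure_approachable
  proof (intro allI impI)
    fix d :: real assume d: "0 < d"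
    have "openin (top_of_set Y) (Y \<inter> ball y0 (d/4))" by auto
    moreover have "y0 \<in> Y \<inter> ball y0 (d/4)" using q0 d by auto
    moreover have "0 < d/8" using d by simp
    ultimately obtain y1 where y1: "y1 \<in> Y \<inter> ball y0 (d/4)" "\<bar>fL y1 - t0\<bar> < d/8" "\<bar>fU y1 - t0\<bar> < d/8"
      by (rule fibre_approximation[OF q0(2,3) order_refl q0(4) _ _ _ finite.emptyI]) blast
    have yY: "y1 \<in> Y" using y1 by simp
    have "\<forall>\<^sub>F n in sequentially. e n < d/8 \<and> fL y1 - d/8 < fL (zc n y1) \<and> fU (zc n y1) < fU y1 + d/8"
      using order_tendstoD(2)[OF e_tendsto, of "d/8"] order_tendstoD(1)[OF fL_zc_tendsto[OF yY], of "fL y1 - d/8"]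
        order_tendstoD(2)[OF fU_zc_tendsto[OF yY], of "fU y1 + d/8"] d
      by (auto intro: eventually_conj)
    then obtain n where n: "e n < d/8" "fL y1 - d/8 < fL (zc n y1)" "fU (zc n y1) < fU y1 + d/8"
      by (auto dest: eventually_happens)
    \<comment> \<open>\<open>P n - c n (fst q)\<close> is minus the label of \<open>q\<close> modulo
      \<open>P n\<close>, so a forward iterate reaches the cell of \<open>y1\<close>.\<close>
    define k where "k = c n y1 + (P n - c n (fst q))"
    have "c n (fst q) < P n" using q c_less by (auto simp: fence_def)
    then have "(c n (fst q) + k) mod P n = c n y1" using c_less[OF yY, of n] by (simp add: k_def)
    then have it: "(T ^^ k) q \<in> F" "c n (fst ((T ^^ k) q)) = c n y1" using T_iterate[OF q, of k n] by auto
    obtain y t where yt: "(T ^^ k) q = (y, t)" by fastforce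
    have y: "y \<in> Y" "fL y \<le> t" "t \<le> fU y" "c n y = c n y1" using it yt by (auto simp: fence_def)
    have "dist y y0 \<le> dist y y1 + dist y1 y0" by (rule dist_triangle)
    then have 1: "dist y y0 < d/2"
      using same_label_close[OF y(1) yY y(4)] n(1) y1(1) by (auto simp: dist_commute)
    have "near (e n) y (zc n y1)" using zc_near[OF y(1), of n] zc_eq[OF y(4)] by simp
    then have 2: "dist t t0 < d/2"
      using y n y1(2,3) unfolding near_def dist_real_def by linarith
    have "dist (y, t) (y0, t0) \<le> dist y y0 + dist t t0"
      unfolding dist_Pair_Pair by (rule sqrt_sum_squares_le_sum) auto
    then have "dist ((T ^^ k) q) q0 < d" using 1 2 yt q0(1) by simp
    then show "\<exists>x\<in>{(T ^^ k) q | k. True}. dist x q0 < d" by blast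
  qed
qed

lemma minimal_T: "minimal_homeomorphism F T"
proof -
  obtain T' where "homeomorphism F F T T'"
    using homeomorphism_compact[OF compact_fence continuous_T T_surj T_inj] by blast
  moreover have "F \<subseteq> closure ({(T ^^ n) x | n. True} \<union> {(T' ^^ n) x | n. True})" if "x \<in> F" for x
    using T_dense[OF that] closure_mono[of "{(T ^^ n) x | n. True}"] by (meson Un_upper1 subset_trans)
  ultimately show ?thesis unfolding minimal_homeomorphism_def by blast
qed

text \<open>Because \<open>p n\<close> divides \<open>P (Suc n)\<close>, the label of stage n+1
  determines a residue modulo \<open>p n\<close>. Conversely a point of the odometer prescribes
  coherent labels, since \<open>P n\<close> divides some \<open>p k\<close>; this gives
  surjectivity.\<close>

lemma odometer_factor:
  assumes p: "odometer_seq p" and dvd: "\<And>n. p n dvd P (Suc n)" "\<And>n. \<exists>k. P n dvd p k"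
  shows "is_factor F T (odometer_space p) (odometer_map p)"
proof -
  define \<pi> where "\<pi> q = (\<lambda>n. c (Suc n) (fst q) mod p n)" for q :: "'a \<times> real"
  have p_pos: "0 < p n" for n using p by (simp add: odometer_seq_def)
  have "continuous_on F \<pi>"
    unfolding \<pi>_def
    by (intro continuous_on_coordinatewise_then_product) (rule continuous_on_label)
  moreover have "\<pi> (T q) = odometer_map p (\<pi> q)" if "q \<in> F" for q
  proof
    fix n
    have y: "fst q \<in> Y" using that by (auto simp: fence_def)
    show "\<pi> (T q) n = odometer_map p (\<pi> q) n"
      using c_S[OF y, of "Suc n"] dvd(1)[of n]
      by (simp add: \<pi>_def odometer_map_def T_def mod_mod_cancel mod_Suc_eq)
  qed
  moreover have "\<pi> ` F = odometer_space p"
  proof (intro equalityI subsetI)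
    fix x assume "x \<in> \<pi> ` F"
    then obtain q where q: "q \<in> F" "x = \<pi> q" by blast
    then have y: "fst q \<in> Y" by (auto simp: fence_def)
    have "x n = x (Suc n) mod p n" for n
    proof -
      have "p n dvd p (Suc n)" using p by (simp add: odometer_seq_def)
      then have "x (Suc n) mod p n = c (Suc (Suc n)) (fst q) mod p n"
        unfolding q(2) \<pi>_def by (rule mod_mod_cancel)
      also have "\<dots> = c (Suc (Suc n)) (fst q) mod P (Suc n) mod p n" using dvd(1) by (simp add: mod_mod_cancel)
      also have "\<dots> = x n" unfolding q(2) \<pi>_def c_Suc_mod[OF y] ..
      finally show ?thesis by simp
    qed
    moreover have "x n < p n" for n unfolding q(2) \<pi>_def using p_pos by simp
    ultimately show "x \<in> odometer_space p" unfolding odometer_space_def by blast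
  next
    fix x assume "x \<in> odometer_space p"
    then have x: "\<And>i. x i < p i" "\<And>i. x i = x (Suc i) mod p i"
      unfolding odometer_space_def by blast+
    have x_mod: "x j mod p i = x i" if "i \<le> j" for i j
      using that
    proof (induction rule: dec_induct)
      case base
      then show ?case using x(1) by simp
    next
      case (step j)
      then show ?case using x(2)[of j] odometer_seq_dvd[OF p step(1)] by (metis mod_mod_cancel)
    qed
    obtain k where k: "\<And>n. P n dvd p (k n)" using dvd(2) by metis
    define v where "v n = x (k n) mod P n" for n
    \<comment> \<open>The label does not depend on which multiple \<open>p j\<close> of
      \<open>P n\<close> is used; coherence of \<open>v\<close> follows by using the same index for
      two stages.\<close>
    have v: "v n = x j mod P n" if "P n dvd p j" for n j
    proof -
      have "x (max (k n) j) mod P n = x i mod P n" if "P n dvd p i" "i \<le> max (k n) j" for i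
        using x_mod[OF that(2)] mod_mod_cancel[OF that(1)] by metis
      from this[OF k] this[OF \<open>P n dvd p j\<close>] show ?thesis unfolding v_def by simp
    qed
    have "\<exists>y\<in>Y. \<forall>n. c n y = v n"
    proof (rule label_exists)
      fix n
      show "v n < P n" using P_pos by (simp add: v_def)
      have "v n = x (k (Suc n)) mod P n" using P_dvd_Suc k by (intro v) (rule dvd_trans)
      also have "\<dots> = v (Suc n) mod P n" using P_dvd_Suc by (simp add: v_def mod_mod_cancel)
      finally show "v (Suc n) mod P n = v n" by simp
    qed
    then obtain y where y: "y \<in> Y" "\<And>n. c n y = v n" by blast
    have "\<pi> (y, fL y) = x"
    proof
      fix n
      have "p n dvd p (k (Suc n))" using dvd(1) k by (rule dvd_trans)
      then have "n \<le> k (Suc n)"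
      proof -
        have "strict_mono p" using p by (simp add: odometer_seq_def strict_mono_Suc_iff)
        moreover have "p n \<le> p (k (Suc n))" using \<open>p n dvd p (k (Suc n))\<close> p_pos by (simp add: dvd_imp_le)
        ultimately show ?thesis by (simp add: strict_mono_less_eq)
      qed
      have "\<pi> (y, fL y) n = x (k (Suc n)) mod P (Suc n) mod p n" by (simp add: \<pi>_def y(2) v_def)
      also have "\<dots> = x (k (Suc n)) mod p n" using dvd(1) by (simp add: mod_mod_cancel)
      also have "\<dots> = x n" by (rule x_mod[OF \<open>n \<le> k (Suc n)\<close>])
      finally show "\<pi> (y, fL y) n = x n" .
    qed
    moreover have "(y, fL y) \<in> F" using y(1) fence_bounds[OF y(1)] by (simp add: fence_def)
    ultimately show "x \<in> \<pi> ` F" by (metis imageI)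
  qed
  ultimately show ?thesis unfolding is_factor_def by blast
qed

end

theorem theorem8p3:
  fixes p :: "nat \<Rightarrow> nat"
    and Y :: "'a::metric_space set"
    and fL fU :: "'a \<Rightarrow> real"
  assumes "odometer_seq p"
    and "fraisse_fence Y fL fU"
  shows "\<exists>T. minimal_homeomorphism (fence Y fL fU) T \<and>
           is_factor (fence Y fL fU) T (odometer_space p) (odometer_map p)"
proof -
  interpret fence_system Y fL fU using assms(2) by unfold_locales
  obtain C P c z where "fence_tower Y fL fU C P c z" and dvd: "\<And>n. p n dvd P (Suc n)" "\<And>n. \<exists>k. P n dvd p k"
    using tower_exists[OF assms(1)] by blast
  then interpret fence_tower Y fL fU C P c z by blast
  show ?thesis using minimal_T odometer_factor[OF assms(1) dvd] by blast
qed

end
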